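(* 1. Let $N\ge 1$ be an integer. The vertex algebra $V_{\sqrt{2N}\,\mathbb{Z}}$ has (as a complex vector space) the basis $$\left\{\mathbf{e}_a \;\middle|\; a\in \mathrm{Fib}^{(N,\,2N-1)}_{\infty}\right\},$$ where $\mathbf{e}_a = e_{\tau(a)_1}\,e_{\tau(a)_2}\,e_{\tau(a)_3}\cdots$ is the semi-infinite monomial attached to $a$. 2. Let $N\ge 1$ be an integer. The vertex superalgebra $V_{\sqrt{2N+1}\,\mathbb{Z}}$ has (as a complex vector space) the basis $$\left\{\mathbf{\Theta}_a \;\middle|\; a\in \mathrm{Fib}^{(0,\,2N)}_{\infty}\right\},$$ where $\mathbf{\Theta}_a = \theta_{\tau(a)_1}\,\theta_{\tau(a)_2}\,\theta_{\tau(a)_3}\cdots$ is the semi-infinite monomial attached to $a$.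
   Context: **Lattice vertex superalgebra.** The Heisenberg Lie algebra is $\mathfrak{H}=\langle C, a_n \mid n\in\mathbb{Z}\rangle_{\mathbb{C}}$ with $[a_n,a_m]=n\,\delta_{n+m,0}\,C$ and $C$ central. $F_\mu$ is the Fock module with highest weight vector $|\mu\rangle$: $C$ acts by $1$, $a_0|\mu\rangle=\mu|\mu\rangle$, $a_n|\mu\rangle=0$ for $n>0$, and $F_\mu$ is freely generated from $|\mu\rangle$ by the $a_{n}$, $n<0$. For a positive integer $M$, $V_{\sqrt{M}\,\mathbb{Z}}=\bigoplus_{\mu\in\sqrt{M}\,\mathbb{Z}}F_\mu$, with vertex operators ($\mu\in\sqrt M\,\mathbb{Z}$) $$V_\mu(z)=Y(|\mu\rangle,z)=e^{\mu q}\,z^{\mu a_0}\exp\Big(-\mu\sum_{n<0}\frac{a_n}{n}z^{-n}\Big)\exp\Big(-\mu\sum_{n>0}\frac{a_n}{n}z^{-n}\Big),$$ where $[a_0,q]=1$, $[a_n,q]=0$ for $n\neq0$, so $e^{\mu q}$ commutes with $a_n$ ($n\ne 0$) and $e^{\mu q}|\lambda\rangle=|\lambda+\mu\rangle$. **Modes.** For $M=2N$: $V_{\sqrt{2N}}(z)=e(z)=\sum_{n\in\mathbb{Z}}e_n z^{-n-N}$; the $e_n$ commute with each other. For $M=2N+1$: $V_{\sqrt{2N+1}}(z)=\theta(z)=\sum_{n\in\mathbb{Z}}\theta_n z^{-n}$; the $\theta_n$ anticommute with each other. **Infinite Fibonacci configurations.** For integers $\theta\ge0$, $l>0$, $\theta\le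 l$, an infinite Fibonacci configuration of type $(\theta,l)$ is a function $a\colon\mathbb{Z}\to\{0,1\}$, $i\mapsto a_i$, such that (1) $a_i+a_{i+1}+\dots+a_{i+l}\le1$ for all $i\in\mathbb Z$; (2) $a_i=0$ for all sufficiently large $i$; (3) for all sufficiently large $n$: $a_{-n}=1$ if $-n\equiv\theta \pmod{l+1}$ and $a_{-n}=0$ otherwise. The set of these is $\mathrm{Fib}^{(\theta,l)}_\infty$. For such $a$, $\tau(a)=(\tau(a)_1<\tau(a)_2<\dots)$ is the increasing enumeration of the set $\{-j\mid a_j=1\}$. **Semi-infinite monomials.** They are vectors of $V_{\sqrt M\,\mathbb Z}$, obtained from the identifications $$|j\sqrt{2N}\rangle = e_{(-2j+1)N}\,e_{(-2j+3)N}\,e_{(-2j+5)N}\cdots,\qquad |j\sqrt{2N+1}\rangle=\theta_{(1-j)(2N+1)}\,\theta_{(2-j)(2N+1)}\,\theta_{(3-j)(2N+1)}\cdots\quad(j\in\mathbb{Z}),$$ which are consistent because $e_{(-2j+1)N}|(j-1)\sqrt{2N}\rangle=|j\sqrt{2N}\rangle$ and $\theta_{(1-j)(2N+1)}|(j-1)\sqrt{2N+1}\rangle=|j\sqrt{2N+1}\rangle$. Explicitly, for $a\in\mathrm{Fib}^{(N,2N-1)}_\infty$ choose $k\geq 0$ and $j\in\mathbb{Z}$ with $\tau(a)_{k+r}=(-2j+2r-1)N$ for all $r\ge1$ and put $\mathbf{e}_a=e_{\tau(a)_1}\cdots e_{\tau(a)_k}|j\sqrt{2N}\rangle$. For $a\in\mathrm{Fib}^{(0,2N)}_\infty$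 choose $k\ge 0$ and $j\in\mathbb Z$ with $\tau(a)_{k+r}=(r-j)(2N+1)$ for all $r\ge1$ and put $\mathbf{\Theta}_a=\theta_{\tau(a)_1}\cdots\theta_{\tau(a)_k}|j\sqrt{2N+1}\rangle$. The result does not depend on the choice of $k$. *)

theory Defs
  imports
    Complex_Main
    "HOL-Library.Multiset"
    "HOL-Library.Poly_Mapping"
    "HOL-Library.Infinite_Set"
    "HOL-Number_Theory.Cong"
begin

section \<open>The space underlying the lattice vertex superalgebra\<close>

text \<open>
  The basis element \<open>(j, A)\<close> stands for
  \<open>(\<Prod>i\<in>#A. a\<^bsub>-(i+1)\<^esub>) |j \<surd>M\<rangle>\<close>: the Fock module \<open>F\<^sub>\<mu>\<close>, \<open>\<mu> = j \<surd>M\<close>, is free over the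
  commuting operators \<open>a\<^sub>n\<close>, \<open>n < 0\<close>, so its monomials are indexed by multisets. Note the shift:
  the element \<open>i\<close> of \<open>A\<close> encodes a factor \<open>a\<^bsub>-(i+1)\<^esub>\<close>, so that every natural number is
  a legal index.  As a vector space \<open>V\<^bsub>\<surd>M \<int>\<^esub>\<close> does not depend on \<open>M\<close>; the lattice enters
  through \<open>a\<^sub>0\<close> and the vertex operators, which carry \<open>M\<close> as an argument.
\<close>

type_synonym latV = "(int \<times> nat multiset) \<Rightarrow>\<^sub>0 complex"

definition scl :: "complex \<Rightarrow> latV \<Rightarrow> latV" where
  "scl c v = Poly_Mapping.map ((*) c) v"

lemma lookup_scl [simp]: "Poly_Mapping.lookup (scl c v) x = c * Poly_Mapping.lookup v x"
  by (simp add: scl_def Poly_Mapping.map.rep_eq when_def)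

global_interpretation latV: vector_space scl
  by unfold_locales (auto intro!: poly_mapping_eqI simp: lookup_add algebra_simps)

definition lin_ext :: "(int \<times> nat multiset \<Rightarrow> latV) \<Rightarrow> latV \<Rightarrow> latV" where
  "lin_ext f v = (\<Sum>x\<in>Poly_Mapping.keys v. scl (Poly_Mapping.lookup v x) (f x))"

definition bvec :: "int \<Rightarrow> nat multiset \<Rightarrow> latV" where
  "bvec j A = Poly_Mapping.single (j, A) 1"

text \<open>The highest weight vector \<open>|j \<surd>M\<rangle>\<close>.\<close>

definition vac :: "int \<Rightarrow> latV" where
  "vac j = bvec j {#}"

section \<open>Heisenberg algebra and vertex operators\<close>

text \<open>
  The action of \<open>a\<^sub>n\<close>, with \<open>C\<close> acting by \<open>1\<close>: for \<open>n > 0\<close> it is \<open>n\<close> times the derivation with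
  respect to \<open>a\<^bsub>-n\<^esub>\<close>, as forced by the commutation relations and \<open>a\<^sub>n |\<mu>\<rangle> = 0\<close>.
\<close>

definition heis :: "nat \<Rightarrow> int \<Rightarrow> latV \<Rightarrow> latV" where
  "heis M n = lin_ext (\<lambda>(j, A).
     if n < 0 then bvec j (add_mset (nat (- n) - 1) A)
     else if n = 0 then scl (of_int j * of_real (sqrt (real M))) (bvec j A)
     else scl (of_int n * of_nat (count A (nat n - 1))) (bvec j (A - {#nat n - 1#})))"

text \<open>\<open>shift_q m\<close> is \<open>e\<^bsup>\<mu>q\<^esup>\<close> for \<open>\<mu> = m \<surd>M\<close>.\<close>

definition shift_q :: "int \<Rightarrow> latV \<Rightarrow> latV" where
  "shift_q m = lin_ext (\<lambda>(j, A). bvec (j + m) A)"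

text \<open>
  \<open>zpow_coeff M m p\<close> is the coefficient of \<open>z\<^bsup>p\<^esup>\<close> in \<open>z\<^bsup>\<mu> a\<^sub>0\<^esup>\<close>, \<open>\<mu> = m \<surd>M\<close>: on the Fock module
  of \<open>j \<surd>M\<close> the exponent \<open>\<mu> a\<^sub>0\<close> is the integer \<open>m j M\<close>.
\<close>

definition zpow_coeff :: "nat \<Rightarrow> int \<Rightarrow> int \<Rightarrow> latV \<Rightarrow> latV" where
  "zpow_coeff M m p = lin_ext (\<lambda>(j, A). if m * j * int M = p then bvec j A else 0)"

text \<open>
  \<open>pow_coeff X k r\<close> is the coefficient of \<open>w\<^bsup>r\<^esup>\<close> in the \<open>k\<close>-th power of the operator-valued
  series \<open>\<Sum>i\<ge>1. X i w\<^bsup>i\<^esup>\<close>, and \<open>exp_coeff X r\<close> its coefficient in the exponential. Since the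
  series has no constant term, its \<open>k\<close>-th power does not contribute for \<open>k > r\<close>.
\<close>

fun pow_coeff :: "(nat \<Rightarrow> latV \<Rightarrow> latV) \<Rightarrow> nat \<Rightarrow> nat \<Rightarrow> latV \<Rightarrow> latV" where
  "pow_coeff X 0 r v = (if r = 0 then v else 0)"
| "pow_coeff X (Suc k) r v = (\<Sum>i=1..r. X i (pow_coeff X k (r - i) v))"

definition exp_coeff :: "(nat \<Rightarrow> latV \<Rightarrow> latV) \<Rightarrow> nat \<Rightarrow> latV \<Rightarrow> latV" where
  "exp_coeff X r v = (\<Sum>k\<le>r. scl (1 / fact k) (pow_coeff X k r v))"

text \<open>The coefficient \<open>- \<mu> a\<^sub>n / n\<close> of \<open>z\<^bsup>-n\<^esup>\<close> in the exponents, \<open>\<mu> = m \<surd>M\<close> and \<open>n \<noteq> 0\<close>.\<close>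

definition expo_term :: "nat \<Rightarrow> int \<Rightarrow> int \<Rightarrow> latV \<Rightarrow> latV" where
  "expo_term M m n v =
     scl (- (of_int m * of_real (sqrt (real M))) / of_int n) (heis M n v)"

text \<open>
  \<open>vop_coeff M m p\<close> is the coefficient of \<open>z\<^bsup>p\<^esup>\<close> in \<open>V\<^sub>\<mu>(z)\<close>, \<open>\<mu> = m \<surd>M\<close>: the creation exponential
  contributes \<open>z\<^bsup>r\<^esup>\<close>, the annihilation exponential \<open>z\<^bsup>-s\<^esup>\<close>. Only finitely many pairs \<open>(r, s)\<close>
  contribute, see \<open>finite_vop_coeff\<close> below.
\<close>

definition vop_coeff :: "nat \<Rightarrow> int \<Rightarrow> int \<Rightarrow> latV \<Rightarrow> latV" where
  "vop_coeff M m p v = (\<Sum>(r, s).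
     shift_q m (zpow_coeff M m (p - int r + int s)
       (exp_coeff (\<lambda>i. expo_term M m (- int i)) r
         (exp_coeff (\<lambda>i. expo_term M m (int i)) s v))))"

definition e_mode :: "nat \<Rightarrow> int \<Rightarrow> latV \<Rightarrow> latV" where
  "e_mode N n = vop_coeff (2 * N) 1 (- n - int N)"

definition theta_mode :: "nat \<Rightarrow> int \<Rightarrow> latV \<Rightarrow> latV" where
  "theta_mode N n = vop_coeff (2 * N + 1) 1 (- n)"

section \<open>Fibonacci configurations and semi-infinite monomials\<close>

definition Fib_inf :: "nat \<Rightarrow> nat \<Rightarrow> (int \<Rightarrow> nat) set" where
  "Fib_inf \<theta> l = {a. (\<forall>i. a i \<in> {0, 1}) \<and>
     (\<forall>i. (\<Sum>k=0..l. a (i + int k)) \<le> 1) \<and>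
     (\<exists>i\<^sub>0. \<forall>i\<ge>i\<^sub>0. a i = 0) \<and>
     (\<exists>n\<^sub>0. \<forall>n\<ge>n\<^sub>0. a (- n) = (if [- n = int \<theta>] (mod (int l + 1)) then 1 else 0))}"

definition increasing_enum :: "int set \<Rightarrow> nat \<Rightarrow> int" where
  "increasing_enum S = (THE f. strict_mono f \<and> range f = S)"

text \<open>\<open>\<tau>(a)\<close> is enumerated from \<open>1\<close>; the value \<open>tau a 0\<close> is irrelevant.\<close>

definition tau :: "(int \<Rightarrow> nat) \<Rightarrow> nat \<Rightarrow> int" where
  "tau a r = increasing_enum {- j | j. a j = 1} (r - 1)"

text \<open>
  The description operator expresses that the vector does not depend on the choice of \<open>k\<close> and \<open>j\<close>;
  existence and uniqueness are \<open>e_mono_eq\<close>, \<open>e_mono_tail\<close>, \<open>Theta_mono_eq\<close>, \<open>Theta_mono_tail\<close>.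
\<close>

definition e_mono :: "nat \<Rightarrow> (int \<Rightarrow> nat) \<Rightarrow> latV" where
  "e_mono N a = (THE v. \<exists>k j.
     (\<forall>r\<ge>1. tau a (k + r) = (- 2 * j + 2 * int r - 1) * int N) \<and>
     v = foldr (\<lambda>i. e_mode N (tau a i)) [1..<k + 1] (vac j))"

definition Theta_mono :: "nat \<Rightarrow> (int \<Rightarrow> nat) \<Rightarrow> latV" where
  "Theta_mono N a = (THE v. \<exists>k j.
     (\<forall>r\<ge>1. tau a (k + r) = (int r - j) * (2 * int N + 1)) \<and>
     v = foldr (\<lambda>i. theta_mode N (tau a i)) [1..<k + 1] (vac j))"

text \<open>A basis is understood as a family: distinct indices give distinct vectors.\<close>

definition is_basis_family :: "('i \<Rightarrow> latV) \<Rightarrow> 'i set \<Rightarrow> bool" where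
  "is_basis_family f I \<longleftrightarrow>
     inj_on f I \<and> latV.independent (f ` I) \<and> latV.span (f ` I) = UNIV"

section \<open>Heisenberg relations\<close>

lemma lin_ext_superset:
  assumes "finite K" "Poly_Mapping.keys v \<subseteq> K"
  shows "lin_ext f v = (\<Sum>x\<in>K. scl (Poly_Mapping.lookup v x) (f x))"
  unfolding lin_ext_def using assms
  by (intro sum.mono_neutral_left) (auto simp: in_keys_iff)

lemma lin_ext_add: "lin_ext f (u + v) = lin_ext f u + lin_ext f v"
proof -
  let ?K = "Poly_Mapping.keys u \<union> Poly_Mapping.keys v"
  have "lin_ext f (u + v) = (\<Sum>x\<in>?K. scl (Poly_Mapping.lookup (u + v) x) (f x))"
    using Poly_Mapping.keys_add[of u v] by (intro lin_ext_superset) auto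
  also have "\<dots> = (\<Sum>x\<in>?K. scl (Poly_Mapping.lookup u x) (f x)) + (\<Sum>x\<in>?K. scl (Poly_Mapping.lookup v x) (f x))"
    by (simp add: lookup_add latV.scale_left_distrib sum.distrib)
  also have "\<dots> = lin_ext f u + lin_ext f v"
    by (subst (1 2) lin_ext_superset[where K = ?K]) auto
  finally show ?thesis .
qed

lemma lin_ext_scl: "lin_ext f (scl c v) = scl c (lin_ext f v)"
proof -
  have "Poly_Mapping.keys (scl c v) \<subseteq> Poly_Mapping.keys v"
    by (auto simp: in_keys_iff)
  then have "lin_ext f (scl c v)
      = (\<Sum>x\<in>Poly_Mapping.keys v. scl (Poly_Mapping.lookup (scl c v) x) (f x))"
    by (intro lin_ext_superset) auto
  then show ?thesis
    by (simp add: lin_ext_def latV.scale_sum_right)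
qed

lemma lin_ext_zero [simp]: "lin_ext f 0 = 0"
  by (simp add: lin_ext_def)

lemma lin_ext_sum: "lin_ext f (sum g I) = (\<Sum>i\<in>I. lin_ext f (g i))"
  by (induction I rule: infinite_finite_induct) (auto simp: lin_ext_add)

lemma lin_ext_bvec [simp]: "lin_ext f (bvec j A) = f (j, A)"
  by (simp add: lin_ext_def bvec_def)

lemma latV_expand: "v = (\<Sum>x\<in>Poly_Mapping.keys v. scl (Poly_Mapping.lookup v x) (bvec (fst x) (snd x)))"
  by (rule poly_mapping_eqI)
    (auto simp: lookup_sum bvec_def lookup_single when_def in_keys_iff if_distrib cong: if_cong)

lemma heis_bvec:
  "heis M n (bvec j A) = (
     if n < 0 then bvec j (add_mset (nat (- n) - 1) A)
     else if n = 0 then scl (of_int j * of_real (sqrt (real M))) (bvec j A)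
     else scl (of_int n * of_nat (count A (nat n - 1))) (bvec j (A - {#nat n - 1#})))"
  by (simp add: heis_def)

lemma heis_add: "heis M n (u + v) = heis M n u + heis M n v"
  and heis_scl: "heis M n (scl c v) = scl c (heis M n v)"
  and heis_zero: "heis M n 0 = 0"
  and heis_sum: "heis M n (sum g I) = (\<Sum>i\<in>I. heis M n (g i))"
  by (simp_all add: heis_def lin_ext_add lin_ext_scl lin_ext_sum)

lemma heis_commutator_bvec_mixed:
  assumes "n < 0" "m > 0"
  shows "heis M n (heis M m (bvec j A)) - heis M m (heis M n (bvec j A))
     = (if n + m = 0 then scl (of_int n) (bvec j A) else 0)"
proof -
  let ?x = "nat (- n) - 1" and ?y = "nat m - 1"
  have nm: "heis M n (heis M m (bvec j A)) =
      scl (of_int m * of_nat (count A ?y)) (bvec j (add_mset ?x (A - {#?y#})))"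
    using assms by (simp add: heis_bvec heis_scl)
  have mn: "heis M m (heis M n (bvec j A)) =
      scl (of_int m * of_nat (count (add_mset ?x A) ?y)) (bvec j (add_mset ?x A - {#?y#}))"
    using assms by (simp add: heis_bvec)
  show ?thesis
  proof (cases "n + m = 0")
    case False
    then have "?x \<noteq> ?y" using assms by linarith
    moreover from this have "add_mset ?x A - {#?y#} = add_mset ?x (A - {#?y#})"
      by (simp add: multiset_eq_iff)
    ultimately show ?thesis using False unfolding nm mn by simp
  next
    case True
    then have m: "m = - n" by simp
    then have xy: "?x = ?y" by simp
    have "scl (of_int m * of_nat (count A ?y)) (bvec j (add_mset ?y (A - {#?y#})))
        = scl (of_int m * of_nat (count A ?y)) (bvec j A)"
      by (cases "count A ?y = 0") (simp_all add: count_eq_zero_iff)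
    then have "heis M n (heis M m (bvec j A)) - heis M m (heis M n (bvec j A)) =
        scl (of_int m * of_nat (count A ?y)) (bvec j A)
        - scl (of_int m * of_nat (Suc (count A ?y))) (bvec j A)"
      unfolding nm mn xy by simp
    also have "\<dots> = scl (of_int m * of_nat (count A ?y) - of_int m * of_nat (Suc (count A ?y))) (bvec j A)"
      by (rule latV.scale_left_diff_distrib[symmetric])
    also have "of_int m * of_nat (count A ?y) - of_int m * of_nat (Suc (count A ?y)) = (of_int n :: complex)"
      by (simp add: m ring_distribs)
    finally show ?thesis using True by simp
  qed
qed

lemma heis_commutator_bvec:
  "heis M n (heis M m (bvec j A)) - heis M m (heis M n (bvec j A))
     = (if n + m = 0 then scl (of_int n) (bvec j A) else 0)"
proof -
  consider "n = 0" | "m = 0" | "n < 0" "m < 0" | "n > 0" "m > 0" | "n < 0" "m > 0" | "n > 0" "m < 0"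
    by linarith
  then show ?thesis
  proof cases
    case 1
    then show ?thesis by (simp add: heis_bvec heis_scl mult.commute)
  next
    case 2
    then show ?thesis by (simp add: heis_bvec heis_scl mult.commute)
  next
    case 3
    then show ?thesis by (simp add: heis_bvec add_mset_commute)
  next
    case 4
    show ?thesis
    proof (cases "n = m")
      case False
      with 4 have "nat n - 1 \<noteq> nat m - 1" by linarith
      moreover have "A - {#nat n - 1#} - {#nat m - 1#} = A - {#nat m - 1#} - {#nat n - 1#}"
        by (simp add: multiset_eq_iff)
      ultimately show ?thesis
        using 4 by (simp add: heis_bvec heis_scl mult_ac del: diff_diff_add_mset)
    qed (use 4 in simp)
  next
    case 5
    then show ?thesis by (rule heis_commutator_bvec_mixed)
  next
    case 6
    have "heis M n (heis M m (bvec j A)) - heis M m (heis M n (bvec j A))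
        = - (heis M m (heis M n (bvec j A)) - heis M n (heis M m (bvec j A)))"
      by (rule minus_diff_eq[symmetric])
    also have "\<dots> = - (if m + n = 0 then scl (of_int m) (bvec j A) else 0)"
      by (subst heis_commutator_bvec_mixed[OF 6(2,1)]) (rule refl)
    also have "\<dots> = (if n + m = 0 then scl (of_int n) (bvec j A) else 0)"
    proof (cases "n + m = 0")
      case True
      then have "m = - n" by simp
      then show ?thesis by simp
    qed simp
    finally show ?thesis .
  qed
qed

theorem heis_commutator:
  "heis M n (heis M m v) - heis M m (heis M n v) = (if n + m = 0 then scl (of_int n) v else 0)"
proof -
  let ?K = "Poly_Mapping.keys v"
  let ?b = "\<lambda>x. bvec (fst x) (snd x)"
  have "heis M n (heis M m v) - heis M m (heis M n v) =
      (\<Sum>x\<in>?K. scl (Poly_Mapping.lookup v x) (heis M n (heis M m (?b x)) - heis M m (heis M n (?b x))))"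
    by (subst (1 2) latV_expand[of v])
       (simp add: heis_sum heis_scl latV.scale_right_diff_distrib sum_subtractf)
  also have "\<dots> = (\<Sum>x\<in>?K. if n + m = 0 then scl (of_int n) (scl (Poly_Mapping.lookup v x) (?b x)) else 0)"
    by (intro sum.cong refl) (simp add: heis_commutator_bvec mult.commute)
  also have "\<dots> = (if n + m = 0
      then scl (of_int n) (\<Sum>x\<in>?K. scl (Poly_Mapping.lookup v x) (?b x)) else 0)"
    by (simp only: latV.scale_sum_right if_distrib sum.neutral_const split: if_splits) simp
  also have "(\<Sum>x\<in>?K. scl (Poly_Mapping.lookup v x) (?b x)) = v"
    by (rule latV_expand[symmetric])
  finally show ?thesis .
qed

lemma heis_vac:
  "n > 0 \<Longrightarrow> heis M n (vac j) = 0"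
  "heis M 0 (vac j) = scl (of_int j * of_real (sqrt (real M))) (vac j)"
  by (simp_all add: vac_def heis_bvec)

lemma bvec_eq_heis: "bvec j (mset ks) = foldr (\<lambda>i. heis M (- int (i + 1))) ks (vac j)"
proof (induction ks)
  case Nil
  show ?case by (simp add: vac_def)
next
  case (Cons i ks)
  have "nat (- (- int (i + 1))) - 1 = i" by simp
  with Cons.IH [symmetric] show ?case by (simp add: heis_bvec)
qed

section \<open>Finiteness of the vertex operator coefficients\<close>

definition wt :: "nat multiset \<Rightarrow> nat" where
  "wt A = (\<Sum>i\<in>#A. Suc i)"

definition homog :: "int \<Rightarrow> (latV \<Rightarrow> latV) \<Rightarrow> bool" where
  "homog d T \<longleftrightarrow> (\<forall>v j B. (j, B) \<in> Poly_Mapping.keys (T v) \<longrightarrow>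
     (\<exists>A. (j, A) \<in> Poly_Mapping.keys v \<and> int (wt B) = int (wt A) + d))"

lemma keys_lin_ext: "Poly_Mapping.keys (lin_ext f v) \<subseteq> (\<Union>x\<in>Poly_Mapping.keys v. Poly_Mapping.keys (f x))"
proof
  fix y assume "y \<in> Poly_Mapping.keys (lin_ext f v)"
  then have "(\<Sum>x\<in>Poly_Mapping.keys v. Poly_Mapping.lookup v x * Poly_Mapping.lookup (f x) y) \<noteq> 0"
    by (simp add: lin_ext_def in_keys_iff lookup_sum)
  then obtain x where "x \<in> Poly_Mapping.keys v"
      "Poly_Mapping.lookup v x * Poly_Mapping.lookup (f x) y \<noteq> 0"
    by (rule sum.not_neutral_contains_not_neutral)
  then show "y \<in> (\<Union>x\<in>Poly_Mapping.keys v. Poly_Mapping.keys (f x))"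
    by (auto simp: in_keys_iff)
qed

lemma keys_lin_extE:
  assumes "y \<in> Poly_Mapping.keys (lin_ext f v)"
  obtains j A where "(j, A) \<in> Poly_Mapping.keys v" "y \<in> Poly_Mapping.keys (lin_ext f (bvec j A))"
proof -
  from assms keys_lin_ext[of f v] obtain x
    where x: "x \<in> Poly_Mapping.keys v" "y \<in> Poly_Mapping.keys (f x)" by blast
  then show thesis by (intro that[of "fst x" "snd x"]) simp_all
qed

lemma keys_scl: "Poly_Mapping.keys (scl c v) = (if c = 0 then {} else Poly_Mapping.keys v)"
  by (auto simp: in_keys_iff)

lemma keys_bvec [simp]: "Poly_Mapping.keys (bvec j A) = {(j, A)}"
  by (simp add: bvec_def)

lemma homog_heis:
  assumes "n \<noteq> 0"
  shows "homog (- n) (heis M n)"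
  unfolding homog_def
proof (intro allI impI)
  fix v j B assume "(j, B) \<in> Poly_Mapping.keys (heis M n v)"
  then obtain j' A where A: "(j', A) \<in> Poly_Mapping.keys v"
    and jB: "(j, B) \<in> Poly_Mapping.keys (heis M n (bvec j' A))"
    unfolding heis_def by (rule keys_lin_extE)
  have "j = j' \<and> int (wt B) = int (wt A) + - n"
  proof (cases "n < 0")
    case True
    then show ?thesis using jB by (simp add: heis_bvec wt_def)
  next
    case False
    with assms have n: "n > 0" by simp
    with jB have *: "count A (nat n - 1) \<noteq> 0" "j = j'" "B = A - {#nat n - 1#}"
      by (auto simp: heis_bvec keys_scl split: if_splits)
    then have A: "A = add_mset (nat n - 1) B"
      by (simp add: count_eq_zero_iff)
    have "wt A = Suc (nat n - 1) + wt B"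
      by (subst A) (simp add: wt_def)
    then show ?thesis using * n by simp
  qed
  with A show "\<exists>A. (j, A) \<in> Poly_Mapping.keys v \<and> int (wt B) = int (wt A) + - n"
    by auto
qed

lemma keys_sumE:
  assumes "y \<in> Poly_Mapping.keys (sum b I)"
  obtains i where "i \<in> I" "y \<in> Poly_Mapping.keys (b i)"
  using keys_sum[of b I] assms by auto

lemma homogE:
  assumes "homog d T" "(j, B) \<in> Poly_Mapping.keys (T v)"
  obtains A where "(j, A) \<in> Poly_Mapping.keys v" "int (wt B) = int (wt A) + d"
  using assms unfolding homog_def by blast

lemma homog_expo_term: "n \<noteq> 0 \<Longrightarrow> homog (- n) (expo_term M m n)"
  using homog_heis[of n M] unfolding homog_def expo_term_def keys_scl
  by (metis empty_iff)

lemma homog_pow_coeff: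
  assumes "\<And>i. i \<ge> 1 \<Longrightarrow> homog (c * int i) (X i)"
  shows "homog (c * int r) (pow_coeff X k r)"
proof (induction k arbitrary: r)
  case 0
  then show ?case by (auto simp: homog_def)
next
  case (Suc k)
  show ?case unfolding homog_def
  proof (intro allI impI)
    fix v j B assume "(j, B) \<in> Poly_Mapping.keys (pow_coeff X (Suc k) r v)"
    then have "(j, B) \<in> Poly_Mapping.keys (\<Sum>i=1..r. X i (pow_coeff X k (r - i) v))"
      by simp
    then obtain i where i: "i \<in> {1..r}"
      and B: "(j, B) \<in> Poly_Mapping.keys (X i (pow_coeff X k (r - i) v))"
      by (rule keys_sumE)
    from i have "i \<ge> 1" by simp
    then obtain C where C: "(j, C) \<in> Poly_Mapping.keys (pow_coeff X k (r - i) v)"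
      and BC: "int (wt B) = int (wt C) + c * int i"
      using homogE[OF assms B] by blast
    obtain A where A: "(j, A) \<in> Poly_Mapping.keys v"
      and CA: "int (wt C) = int (wt A) + c * int (r - i)"
      using homogE[OF Suc.IH C] by blast
    have "int (wt B) = int (wt A) + c * int r"
      using BC CA i by (simp add: of_nat_diff algebra_simps)
    with A show "\<exists>A. (j, A) \<in> Poly_Mapping.keys v \<and> int (wt B) = int (wt A) + c * int r"
      by blast
  qed
qed

lemma homog_exp_coeff:
  assumes "\<And>i. i \<ge> 1 \<Longrightarrow> homog (c * int i) (X i)"
  shows "homog (c * int r) (exp_coeff X r)"
  unfolding homog_def
proof (intro allI impI)
  fix v j B assume "(j, B) \<in> Poly_Mapping.keys (exp_coeff X r v)"
  then obtain k where "(j, B) \<in> Poly_Mapping.keys (scl (1 / fact k) (pow_coeff X k r v))"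
    unfolding exp_coeff_def by (rule keys_sumE)
  then have "(j, B) \<in> Poly_Mapping.keys (pow_coeff X k r v)"
    by (simp add: keys_scl)
  with homog_pow_coeff[of c X r k, OF assms]
  show "\<exists>A. (j, A) \<in> Poly_Mapping.keys v \<and> int (wt B) = int (wt A) + c * int r"
    by (rule homogE) blast+
qed

lemma homog_creation: "homog (int r) (exp_coeff (\<lambda>i. expo_term M m (- int i)) r)"
  using homog_exp_coeff[of 1 "\<lambda>i. expo_term M m (- int i)" r]
    homog_expo_term[of "- int i" M m for i] by fastforce

lemma homog_annihilation: "homog (- int s) (exp_coeff (\<lambda>i. expo_term M m (int i)) s)"
  using homog_exp_coeff[of "-1" "\<lambda>i. expo_term M m (int i)" s]
    homog_expo_term[of "int i" M m for i] by fastforce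

lemma homog_zero: "homog d T \<Longrightarrow> T 0 = 0"
  unfolding homog_def by (metis equals0D keys_eq_empty keys_zero surj_pair subsetI subset_empty)

lemma zpow_coeff_nonzero:
  assumes "zpow_coeff M m p v \<noteq> 0"
  shows "\<exists>j A. (j, A) \<in> Poly_Mapping.keys v \<and> m * j * int M = p"
proof (rule ccontr)
  assume "\<not> ?thesis"
  then have "zpow_coeff M m p v = 0"
    unfolding zpow_coeff_def lin_ext_def by (intro sum.neutral) auto
  with assms show False by simp
qed

theorem finite_vop_coeff:
  "finite {(r, s).
     shift_q m (zpow_coeff M m (p - int r + int s)
       (exp_coeff (\<lambda>i. expo_term M m (- int i)) r
         (exp_coeff (\<lambda>i. expo_term M m (int i)) s v))) \<noteq> 0}" (is "finite ?S")
proof (rule finite_subset)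
  let ?T = "\<Union>(j, A)\<in>Poly_Mapping.keys v. (\<lambda>s. (nat (p + int s - m * j * int M), s)) ` {..wt A}"
  show "finite ?T" by auto
  show "?S \<subseteq> ?T"
  proof (clarify)
    fix r s
    let ?w = "exp_coeff (\<lambda>i. expo_term M m (int i)) s v"
    let ?u = "exp_coeff (\<lambda>i. expo_term M m (- int i)) r ?w"
    assume "shift_q m (zpow_coeff M m (p - int r + int s) ?u) \<noteq> 0"
    then have "zpow_coeff M m (p - int r + int s) ?u \<noteq> 0"
      by (auto simp: shift_q_def)
    then obtain j C where "(j, C) \<in> Poly_Mapping.keys ?u" and p: "m * j * int M = p - int r + int s"
      using zpow_coeff_nonzero by blast
    then obtain B where "(j, B) \<in> Poly_Mapping.keys ?w"
      using homog_creation[of r M m] unfolding homog_def by blast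
    then obtain A where A: "(j, A) \<in> Poly_Mapping.keys v" and "int (wt B) = int (wt A) + - int s"
      using homog_annihilation[of s M m] unfolding homog_def by blast
    then have "s \<le> wt A" "r = nat (p + int s - m * j * int M)" using p by auto
    with A show "(r, s) \<in> ?T" by force
  qed
qed

lemma exp_coeff_0 [simp]: "exp_coeff X 0 v = v"
  by (simp add: exp_coeff_def)

theorem vop_coeff_vac: "vop_coeff M m (m * j * int M) (vac j) = vac (j + m)"
proof -
  let ?p = "m * j * int M"
  let ?P = "\<lambda>s. exp_coeff (\<lambda>i. expo_term M m (int i)) s (vac j)"
  let ?Q = "\<lambda>r. exp_coeff (\<lambda>i. expo_term M m (- int i)) r"
  let ?g = "\<lambda>(r, s). shift_q m (zpow_coeff M m (?p - int r + int s) (?Q r (?P s)))"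
  have P: "?P s = 0" if "s > 0" for s
  proof (rule ccontr)
    assume "?P s \<noteq> 0"
    then obtain j' B where "(j', B) \<in> Poly_Mapping.keys (?P s)"
      by (metis all_not_in_conv keys_eq_empty surj_pair)
    then obtain A where A: "(j', A) \<in> Poly_Mapping.keys (vac j)" "int (wt B) = int (wt A) + - int s"
      using homog_annihilation[of s M m] unfolding homog_def by blast
    then have "wt A = 0" by (simp add: vac_def wt_def)
    with A(2) that show False by linarith
  qed
  have g: "?g (r, s) = 0" if "(r, s) \<noteq> (0, 0)" for r s
  proof (cases "s = 0")
    case False
    then show ?thesis
      using P[of s] homog_zero[OF homog_creation] by (simp add: zpow_coeff_def shift_q_def)
  next
    case True
    with that have r: "r > 0" by simp
    have "zpow_coeff M m (?p - int r) (?Q r (vac j)) = 0"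
    proof (rule ccontr)
      assume "zpow_coeff M m (?p - int r) (?Q r (vac j)) \<noteq> 0"
      then obtain j' B where "(j', B) \<in> Poly_Mapping.keys (?Q r (vac j))" "m * j' * int M = ?p - int r"
        using zpow_coeff_nonzero by blast
      moreover from this have "j' = j"
        using homog_creation[of r M m] unfolding homog_def by (fastforce simp: vac_def)
      ultimately show False using r by simp
    qed
    with True show ?thesis by (simp add: shift_q_def)
  qed
  have supp: "{x. ?g x \<noteq> 0} \<subseteq> {(0, 0)}"
  proof
    fix x assume "x \<in> {x. ?g x \<noteq> 0}"
    then have "?g x \<noteq> 0" by (rule CollectD)
    then show "x \<in> {(0, 0)}"
      using g[of "fst x" "snd x"] unfolding prod.collapse by blast
  qed
  have "vop_coeff M m ?p (vac j) = sum ?g {(0, 0)}"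
    unfolding vop_coeff_def by (rule Sum_any.expand_superset[OF _ supp]) simp
  also have "\<dots> = vac (j + m)"
    by (simp add: zpow_coeff_def shift_q_def vac_def)
  finally show ?thesis .
qed

lemma e_mode_vac: "e_mode N ((- 2 * j + 1) * int N) (vac (j - 1)) = vac j"
  using vop_coeff_vac[of "2 * N" 1 "j - 1"] by (simp add: e_mode_def algebra_simps)

lemma theta_mode_vac: "theta_mode N ((1 - j) * (2 * int N + 1)) (vac (j - 1)) = vac j"
  using vop_coeff_vac[of "2 * N + 1" 1 "j - 1"] by (simp add: theta_mode_def algebra_simps)

section \<open>Well-definedness of the semi-infinite monomials\<close>

lemma strict_mono_range_unique:
  fixes f g :: "nat \<Rightarrow> int"
  assumes "strict_mono f" "strict_mono g" "range f = range g"
  shows "f = g"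
proof
  fix n show "f n = g n"
  proof (induction n rule: less_induct)
    case (less n)
    have "f n \<in> range g" by (simp flip: assms(3))
    then obtain i where i: "f n = g i" by blast
    have "g n \<in> range f" by (simp add: assms(3))
    then obtain k where k: "g n = f k" by blast
    have "n \<le> i"
    proof (rule ccontr)
      assume "\<not> n \<le> i"
      then have "i < n" by simp
      then have "f i = g i" by (rule less)
      moreover have "f i < f n" using \<open>i < n\<close> assms(1) by (simp add: strict_mono_less)
      ultimately have "g i < f n" by simp
      with i show False by simp
    qed
    then have 1: "g n \<le> f n" using i assms(2) by (simp add: strict_mono_less_eq)
    have "n \<le> k"
    proof (rule ccontr)
      assume "\<not> n \<le> k"
      then have "k < n" by simp
      then have "f k = g k" by (rule less)
      moreover have "g k < g n" using \<open>k < n\<close> assms(2) by (simp add: strict_mono_less)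
      ultimately have "f k < g n" by simp
      with k show False by simp
    qed
    then have "f n \<le> g n" using k assms(1) by (simp add: strict_mono_less_eq)
    with 1 have "f n = g n" by simp
    then show ?case by simp
  qed
qed

lemma increasing_enum:
  assumes "infinite S" "\<And>x. x \<in> S \<Longrightarrow> b \<le> x"
  shows "strict_mono (increasing_enum S)" "range (increasing_enum S) = S"
proof -
  let ?S = "(\<lambda>x. nat (x - b)) ` S"
  let ?f = "\<lambda>n. int (enumerate ?S n) + b"
  have "inj_on (\<lambda>x. nat (x - b)) S"
    using assms(2) by (auto intro!: inj_onI simp: eq_nat_nat_iff)
  then have inf: "infinite ?S" using assms(1) finite_imageD by blast
  have mono: "strict_mono ?f" using inf by (auto intro!: strict_monoI enumerate_mono)
  have range: "range ?f = S"
  proof -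
    have "range ?f = (\<lambda>n. int n + b) ` range (enumerate ?S)"
      unfolding image_image ..
    also have "\<dots> = (\<lambda>n. int n + b) ` ?S"
      by (simp only: range_enumerate[OF inf])
    also have "\<dots> = (\<lambda>x. x) ` S"
      unfolding image_image using assms(2) by (intro image_cong) auto
    finally show ?thesis by simp
  qed
  have "\<exists>!f :: nat \<Rightarrow> int. strict_mono f \<and> range f = S"
  proof (rule ex1I[of _ ?f])
    show "strict_mono ?f \<and> range ?f = S" using mono range by blast
    fix g :: "nat \<Rightarrow> int" assume g: "strict_mono g \<and> range g = S"
    show "g = ?f"
    proof (rule strict_mono_range_unique)
      show "strict_mono g" using g by blast
      show "strict_mono ?f" by (rule mono)
      show "range g = range ?f" unfolding range using g by blast
    qed
  qed
  from theI'[OF this] show "strict_mono (increasing_enum S)" "range (increasing_enum S) = S"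
    by (simp_all add: increasing_enum_def)
qed

lemma enum_tail:
  fixes f :: "nat \<Rightarrow> int"
  assumes f: "strict_mono f" and d: "d > 0"
    and S: "\<And>t. t \<ge> t0 \<Longrightarrow> t \<in> range f \<longleftrightarrow> [t = c] (mod d)"
  shows "\<exists>k q. \<forall>r. f (k + r) = c + d * (q + int r)"
proof -
  have grow: "f n \<ge> f 0 + int n" for n
  proof (induction n)
    case (Suc n)
    have "f n < f (Suc n)" using f by (simp add: strict_mono_less)
    with Suc show ?case by simp
  qed simp
  define k where "k = nat (t0 - f 0)"
  have k: "f (k + r) \<ge> t0" for r using grow[of "k + r"] unfolding k_def by linarith
  then have "[f k = c] (mod d)" using S[of "f k"] k[of 0] by auto
  then have "d dvd f k - c" by (simp add: cong_iff_dvd_diff)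
  then obtain q where "f k - c = d * q" by (rule dvdE)
  then have q: "f k = c + d * q" by simp
  have "f (k + r) = c + d * (q + int r)" for r
  proof (induction r)
    case 0
    then show ?case using q by simp
  next
    case (Suc r)
    let ?x = "f (k + r)" and ?y = "f (k + Suc r)"
    have x: "[?x = c] (mod d)" using S k[of r] by blast
    have y: "[?y = c] (mod d)" using S k[of "Suc r"] by blast
    have less: "?x < ?y" using f by (simp add: strict_mono_less)
    have "[?x + d = c] (mod d)" using x by (simp add: cong_def)
    then have "?x + d \<in> range f" using S[of "?x + d"] k[of r] d by simp
    then obtain i where i: "?x + d = f i" by auto
    then have "f (k + r) < f i" using d by linarith
    then have "k + r < i" using f strict_mono_less by blast
    then have "?y \<le> ?x + d" using i f by (simp add: strict_mono_less_eq)
    moreover have "[?y = ?x] (mod d)" using y cong_sym[OF x] by (rule cong_trans)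
    then have "d dvd ?y - ?x" by (simp add: cong_iff_dvd_diff)
    then have "d \<le> ?y - ?x" using less by (simp add: zdvd_imp_le)
    ultimately have "?y = ?x + d" by simp
    then show ?case using Suc.IH by (simp add: algebra_simps)
  qed
  then show ?thesis by blast
qed

lemma Fib_tau_tail:
  assumes "a \<in> Fib_inf \<theta> l"
  shows "\<exists>k q. \<forall>r\<ge>1. tau a (k + r) = - int \<theta> + (int l + 1) * (q + int r)"
proof -
  let ?S = "{- j | j. a j = 1}" and ?d = "int l + 1"
  have S: "t \<in> ?S \<longleftrightarrow> a (- t) = 1" for t
    by (auto intro: exI[of _ "- t"])
  obtain i0 where i0: "\<And>i. i \<ge> i0 \<Longrightarrow> a i = 0" using assms unfolding Fib_inf_def by blast
  obtain n0 where n0: "\<And>n. n \<ge> n0 \<Longrightarrow>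
      a (- n) = (if [- n = int \<theta>] (mod (int l + 1)) then 1 else 0)"
    using assms unfolding Fib_inf_def by blast
  have cong: "[- t = int \<theta>] (mod ?d) \<longleftrightarrow> [t = - int \<theta>] (mod ?d)" for t
    by (metis cong_minus_minus_iff minus_minus)
  have tail: "t \<in> ?S \<longleftrightarrow> [t = - int \<theta>] (mod ?d)" if "t \<ge> n0" for t
    using S[of t] n0[OF that] cong[of t] by auto
  have lower: "- i0 \<le> t" if "t \<in> ?S" for t
    using i0[of "- t"] S[of t] that by (cases "i0 \<le> - t") auto
  have "infinite ?S"
  proof
    assume fin: "finite ?S"
    define m where "m = Max ?S"
    define X where "X = \<bar>n0\<bar> + \<bar>m\<bar> + int \<theta> + 1"
    define t where "t = - int \<theta> + ?d * X"
    have "X \<ge> 0" by (simp add: X_def)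
    then have "1 * X \<le> ?d * X" by (intro mult_right_mono) auto
    then have "X - int \<theta> \<le> t" by (simp add: t_def)
    then have t: "t \<ge> n0" "t > m" unfolding X_def by linarith+
    have "[t = - int \<theta>] (mod ?d)" by (simp add: t_def cong_iff_dvd_diff)
    with tail[OF t(1)] have "t \<in> ?S" by simp
    then have "t \<le> m" unfolding m_def using fin by (intro Max_ge)
    with t(2) show False by simp
  qed
  note f = increasing_enum[OF this lower]
  obtain k q where kq: "\<And>r. increasing_enum ?S (k + r) = - int \<theta> + ?d * (q + int r)"
    using enum_tail[OF f(1), of ?d n0 "- int \<theta>"] tail f(2) by auto
  have "tau a (k + r) = - int \<theta> + ?d * (q - 1 + int r)" if "r \<ge> 1" for r
  proof -
    have "tau a (k + r) = increasing_enum ?S (k + (r - 1))" using that by (simp add: tau_def)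
    also have "\<dots> = - int \<theta> + ?d * (q - 1 + int r)"
      using that by (simp only: kq) (simp add: of_nat_diff algebra_simps)
    finally show ?thesis .
  qed
  then show ?thesis by blast
qed

lemma e_mono_tail:
  assumes "1 \<le> N" "a \<in> Fib_inf N (2 * N - 1)"
  shows "\<exists>k j. \<forall>r\<ge>1. tau a (k + r) = (- 2 * j + 2 * int r - 1) * int N"
proof -
  obtain k q where "\<And>r. r \<ge> 1 \<Longrightarrow>
      tau a (k + r) = - int N + (int (2 * N - 1) + 1) * (q + int r)"
    using Fib_tau_tail[OF assms(2)] by blast
  moreover have "int (2 * N - 1) + 1 = 2 * int N" using assms(1) by simp
  ultimately have "\<forall>r\<ge>1. tau a (k + r) = (- 2 * (- q) + 2 * int r - 1) * int N"
    by (simp add: algebra_simps)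
  then show ?thesis by blast
qed

lemma Theta_mono_tail:
  assumes "a \<in> Fib_inf 0 (2 * N)"
  shows "\<exists>k j. \<forall>r\<ge>1. tau a (k + r) = (int r - j) * (2 * int N + 1)"
proof -
  obtain k q where "\<And>r. r \<ge> 1 \<Longrightarrow> tau a (k + r) = (int (2 * N) + 1) * (q + int r)"
    using Fib_tau_tail[OF assms] by auto
  then have "\<forall>r\<ge>1. tau a (k + r) = (int r - (- q)) * (2 * int N + 1)"
    by (simp add: algebra_simps)
  then show ?thesis by blast
qed

lemma semi_infinite_unique:
  fixes T :: "nat \<Rightarrow> int" and c :: "int \<Rightarrow> int"
  assumes c: "inj c" and E: "\<And>j. E (c j) (vac (j - 1)) = vac j"
    and kj: "\<And>r. r \<ge> 1 \<Longrightarrow> T (k + r) = c (j - int r + 1)"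
    and kj': "\<And>r. r \<ge> 1 \<Longrightarrow> T (k' + r) = c (j' - int r + 1)"
  shows "foldr (\<lambda>i. E (T i)) [1..<k + 1] (vac j) = foldr (\<lambda>i. E (T i)) [1..<k' + 1] (vac j')"
proof -
  have *: "foldr (\<lambda>i. E (T i)) [1..<k + 1] (vac j) = foldr (\<lambda>i. E (T i)) [1..<k' + 1] (vac j')"
    if "k \<le> k'" and kj: "\<And>r. r \<ge> 1 \<Longrightarrow> T (k + r) = c (j - int r + 1)"
      and kj': "\<And>r. r \<ge> 1 \<Longrightarrow> T (k' + r) = c (j' - int r + 1)" for k k' j j'
  proof -
    have ext: "foldr (\<lambda>i. E (T i)) [1..<k + d + 1] (vac (j - int d))
        = foldr (\<lambda>i. E (T i)) [1..<k + 1] (vac j)" for d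
    proof (induction d)
      case (Suc d)
      have "T (k + Suc d) = c (j - int d)" using kj[of "Suc d"] by simp
      then have "E (T (k + Suc d)) (vac (j - int (Suc d))) = vac (j - int d)"
        using E[of "j - int d"] by (simp add: algebra_simps)
      then show ?case using Suc.IH by simp
    qed simp
    define d where "d = k' - k"
    have d: "k' = k + d" using that(1) by (simp add: d_def)
    have "c (j' - int 1 + 1) = c (j - int (d + 1) + 1)"
      using kj'[of 1] kj[of "d + 1"] d by simp
    then have "j' = j - int d" using injD[OF c] by fastforce
    then show ?thesis using ext[of d] d by simp
  qed
  show ?thesis
    using *[of k k' j j', OF _ kj kj'] *[of k' k j' j, OF _ kj' kj] by (cases "k \<le> k'") simp_all
qed

theorem e_mono_eq:
  assumes N: "1 \<le> N"
    and kj: "\<forall>r\<ge>1. tau a (k + r) = (- 2 * j + 2 * int r - 1) * int N"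
  shows "e_mono N a = foldr (\<lambda>i. e_mode N (tau a i)) [1..<k + 1] (vac j)"
  unfolding e_mono_def
proof (rule the_equality)
  show "\<exists>k' j'. (\<forall>r\<ge>1. tau a (k' + r) = (- 2 * j' + 2 * int r - 1) * int N) \<and>
      foldr (\<lambda>i. e_mode N (tau a i)) [1..<k + 1] (vac j)
        = foldr (\<lambda>i. e_mode N (tau a i)) [1..<k' + 1] (vac j')"
    using kj by blast
next
  fix v assume "\<exists>k' j'. (\<forall>r\<ge>1. tau a (k' + r) = (- 2 * j' + 2 * int r - 1) * int N) \<and>
      v = foldr (\<lambda>i. e_mode N (tau a i)) [1..<k' + 1] (vac j')"
  then obtain k' j' where kj': "\<forall>r\<ge>1. tau a (k' + r) = (- 2 * j' + 2 * int r - 1) * int N"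
    and v: "v = foldr (\<lambda>i. e_mode N (tau a i)) [1..<k' + 1] (vac j')" by blast
  let ?c = "\<lambda>j. (- 2 * j + 1) * int N"
  have c: "inj ?c" using N by (auto intro!: injI)
  have "foldr (\<lambda>i. e_mode N (tau a i)) [1..<k' + 1] (vac j')
      = foldr (\<lambda>i. e_mode N (tau a i)) [1..<k + 1] (vac j)"
    using kj kj' by (intro semi_infinite_unique[OF c e_mode_vac]) (auto simp: algebra_simps)
  with v show "v = foldr (\<lambda>i. e_mode N (tau a i)) [1..<k + 1] (vac j)" by simp
qed

theorem Theta_mono_eq:
  assumes kj: "\<forall>r\<ge>1. tau a (k + r) = (int r - j) * (2 * int N + 1)"
  shows "Theta_mono N a = foldr (\<lambda>i. theta_mode N (tau a i)) [1..<k + 1] (vac j)"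
  unfolding Theta_mono_def
proof (rule the_equality)
  show "\<exists>k' j'. (\<forall>r\<ge>1. tau a (k' + r) = (int r - j') * (2 * int N + 1)) \<and>
      foldr (\<lambda>i. theta_mode N (tau a i)) [1..<k + 1] (vac j)
        = foldr (\<lambda>i. theta_mode N (tau a i)) [1..<k' + 1] (vac j')"
    using kj by blast
next
  fix v assume "\<exists>k' j'. (\<forall>r\<ge>1. tau a (k' + r) = (int r - j') * (2 * int N + 1)) \<and>
      v = foldr (\<lambda>i. theta_mode N (tau a i)) [1..<k' + 1] (vac j')"
  then obtain k' j' where kj': "\<forall>r\<ge>1. tau a (k' + r) = (int r - j') * (2 * int N + 1)"
    and v: "v = foldr (\<lambda>i. theta_mode N (tau a i)) [1..<k' + 1] (vac j')" by blast
  let ?c = "\<lambda>j. (1 - j) * (2 * int N + 1)"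
  have "2 * int N + 1 \<noteq> 0" by linarith
  then have c: "inj ?c" by (auto intro!: injI)
  have "foldr (\<lambda>i. theta_mode N (tau a i)) [1..<k' + 1] (vac j')
      = foldr (\<lambda>i. theta_mode N (tau a i)) [1..<k + 1] (vac j)"
    using kj kj' by (intro semi_infinite_unique[OF c theta_mode_vac]) (auto simp: algebra_simps)
  with v show "v = foldr (\<lambda>i. theta_mode N (tau a i)) [1..<k + 1] (vac j)" by simp
qed

end

theory Submission
  imports Defs
begin

text \<open>
  Write \<open>C\<^sub>r\<close> and \<open>S\<^sub>s\<close> for the coefficients of the creation and annihilation exponentials. On a
  vector \<open>v\<close> of charge \<open>n\<close>, the coefficient of \<open>z\<^bsup>nM+r\<^esup>\<close> in the vertex operator is, up to the charge
  shift, \<open>\<Sum>\<^sub>s C\<^bsub>r+s\<^esub> S\<^sub>s v\<close>, so it equals \<open>C\<^sub>r v\<close> modulo the span of the images of \<open>C\<^bsub>r+1\<^esub>, C\<^bsub>r+2\<^esub>, \<dots>\<close>; only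
  the degree of \<open>S\<^sub>s\<close> matters. By Newton's identity \<open>r C\<^sub>r = \<surd>M \<Sum>\<^sub>i a\<^bsub>-i\<^esub> C\<^bsub>r-i\<^esub>\<close> the images of the
  commuting operators \<open>C\<^sub>r\<close>, \<open>r \<ge> 1\<close>, span every graded piece of positive degree. A downward induction
  on \<open>r\<close> inside an induction on the degree therefore shows that the monomials indexed by the
  partitions of \<open>d\<close> span the piece of degree \<open>d\<close> of each charge. The dimension of this piece is the
  number of partitions of \<open>d\<close>, hence they form a basis. A Fibonacci configuration is the same thing
  as a charge and a partition: subtract the densest configuration of that charge.
\<close>

section \<open>Exponentials of commuting operators\<close>

abbreviation lin_op :: "(latV \<Rightarrow> latV) \<Rightarrow> bool" where
  "lin_op \<equiv> module_hom scl scl"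

lemma lin_opI:
  assumes "\<And>u v. T (u + v) = T u + T v" "\<And>c v. T (scl c v) = scl c (T v)"
  shows "lin_op T"
  using assms by (simp add: module_hom_iff latV.module_axioms)

lemma lin_op_lin_ext: "lin_op (lin_ext f)"
  by (intro lin_opI lin_ext_add lin_ext_scl)

lemma lin_op_eqI:
  assumes "lin_op S" "lin_op T" "\<And>j A. S (bvec j A) = T (bvec j A)"
  shows "S v = T v"
  by (subst (1 2) latV_expand[of v])
    (simp add: module_hom.sum[OF assms(1)] module_hom.sum[OF assms(2)]
      module_hom.scale[OF assms(1)] module_hom.scale[OF assms(2)] assms(3))

lemma lin_op_pow_coeff:
  assumes "\<And>i. lin_op (X i)"
  shows "lin_op (pow_coeff X k r)"
proof (induction k arbitrary: r)
  case 0
  show ?case by (rule lin_opI) auto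
next
  case (Suc k)
  show ?case
    by (rule lin_opI)
      (simp_all add: module_hom.add[OF Suc.IH] module_hom.scale[OF Suc.IH]
        module_hom.add[OF assms] module_hom.scale[OF assms] sum.distrib latV.scale_sum_right)
qed

lemma lin_op_exp_coeff:
  assumes "\<And>i. lin_op (X i)"
  shows "lin_op (exp_coeff X r)"
  by (rule lin_opI)
    (simp_all add: exp_coeff_def module_hom.add[OF lin_op_pow_coeff[OF assms]]
      module_hom.scale[OF lin_op_pow_coeff[OF assms]] latV.scale_right_distrib sum.distrib
      latV.scale_sum_right mult.commute)

lemma pow_coeff_commute:
  assumes "lin_op T" "\<And>i v. T (X i v) = X i (T v)"
  shows "T (pow_coeff X k r v) = pow_coeff X k r (T v)"
  by (induction k arbitrary: r)
    (simp_all add: module_hom.zero[OF assms(1)] module_hom.sum[OF assms(1)] assms(2))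

lemma exp_coeff_commute:
  assumes "lin_op T" "\<And>i v. T (X i v) = X i (T v)"
  shows "T (exp_coeff X r v) = exp_coeff X r (T v)"
  by (simp add: exp_coeff_def module_hom.sum[OF assms(1)] module_hom.scale[OF assms(1)]
      pow_coeff_commute[of T X, OF assms])

lemma pow_coeff_eq_0: "r < k \<Longrightarrow> (\<And>i. X i 0 = 0) \<Longrightarrow> pow_coeff X k r v = 0"
proof (induction k arbitrary: r)
  case (Suc k)
  have "X i (pow_coeff X k (r - i) v) = 0" if "i \<in> {1..r}" for i
    using Suc.IH[of "r - i"] Suc.prems that by auto
  then show ?case by simp
qed simp

text \<open>The coefficientwise form of \<open>w d/dw X(w)\<^bsup>k+1\<^esup> = (k+1) (w d/dw X(w)) X(w)\<^bsup>k\<^esup>\<close>.\<close>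

lemma pow_coeff_euler:
  assumes lin: "\<And>i. lin_op (X i)" and comm: "\<And>i l v. X i (X l v) = X l (X i v)"
  shows "scl (of_nat r) (pow_coeff X (Suc k) r v)
    = scl (of_nat (Suc k)) (\<Sum>i=1..r. scl (of_nat i) (X i (pow_coeff X k (r - i) v)))"
proof (induction k arbitrary: r)
  case 0
  have "scl (of_nat r) (X i (if r - i = 0 then v else 0))
      = scl (of_nat i) (X i (if r - i = 0 then v else 0))"
    if "i \<in> {1..r}" for i
    using that by (cases "r = i") (auto simp: module_hom.zero[OF lin])
  then show ?case
    by (simp only: pow_coeff.simps latV.scale_sum_right of_nat_1 latV.scale_one cong: sum.cong) simp
next
  case (Suc k)
  let ?P = "\<lambda>k r. pow_coeff X k r v"
  let ?D = "\<Sum>i=1..r. scl (of_nat i) (X i (?P (Suc k) (r - i)))"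
  have eq: "X i (scl (of_nat (r - i)) (?P (Suc k) (r - i))) = scl (of_nat (Suc k))
        (\<Sum>l=1..r-i. scl (of_nat l) (X l (X i (?P k (r - i - l)))))" for i
    by (subst Suc.IH)
      (simp only: module_hom.sum[OF lin] module_hom.scale[OF lin] comm[of i])
  have "scl (of_nat r) (?P (Suc (Suc k)) r) = (\<Sum>i=1..r. scl (of_nat r) (X i (?P (Suc k) (r - i))))"
    by (simp only: pow_coeff.simps(2)[of X "Suc k"] latV.scale_sum_right)
  \<comment> \<open>The weight r is split as i + (r - i); the part r - i falls on the inner power,
    where the induction hypothesis applies.\<close>
  also have "\<dots> = (\<Sum>i=1..r. scl (of_nat i) (X i (?P (Suc k) (r - i)))
      + X i (scl (of_nat (r - i)) (?P (Suc k) (r - i))))"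
    by (intro sum.cong refl)
      (simp add: module_hom.scale[OF lin] of_nat_diff flip: latV.scale_left_distrib)
  also have "\<dots> = ?D + scl (of_nat (Suc k)) (\<Sum>i=1..r.
        (\<Sum>l=1..r-i. scl (of_nat l) (X l (X i (?P k (r - i - l))))))"
    by (simp only: eq sum.distrib latV.scale_sum_right)
  also have "(\<Sum>i=1..r. (\<Sum>l=1..r-i. scl (of_nat l) (X l (X i (?P k (r - i - l))))))
      = (\<Sum>i\<in>{1..r}. \<Sum>l\<in>{l. l\<in>{1..r} \<and> i + l \<le> r}. scl (of_nat l) (X l (X i (?P k (r - i - l)))))"
    by (intro sum.cong refl) auto
  also have "\<dots> = (\<Sum>l\<in>{1..r}. \<Sum>i\<in>{i. i\<in>{1..r} \<and> i + l \<le> r}. scl (of_nat l) (X l (X i (?P k (r - i - l)))))"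
    by (rule sum.swap_restrict) auto
  also have "\<dots> = (\<Sum>l=1..r. \<Sum>i=1..r-l. scl (of_nat l) (X l (X i (?P k (r - l - i)))))"
    by (intro sum.cong refl) (auto simp: diff_commute add.commute)
  also have "\<dots> = ?D"
    by (simp add: module_hom.sum[OF lin] latV.scale_sum_right)
  also have "?D + scl (of_nat (Suc k)) ?D = scl (of_nat (Suc (Suc k))) ?D"
    by (simp only: of_nat_Suc[of "Suc k"] latV.scale_left_distrib latV.scale_one)
  finally show ?case .
qed

text \<open>Summing the preceding identity with weights 1/(k+1)! gives w dE/dw = (w dX/dw) E for the
  exponential E of the series X.\<close>

lemma exp_coeff_newton:
  assumes lin: "\<And>i. lin_op (X i)" and comm: "\<And>i l v. X i (X l v) = X l (X i v)"
  shows "scl (of_nat r) (exp_coeff X r v)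
    = (\<Sum>i=1..r. scl (of_nat i) (X i (exp_coeff X (r - i) v)))"
proof (cases r)
  case (Suc n)
  have step: "scl (of_nat r) (scl (1 / fact (Suc k)) (pow_coeff X (Suc k) r v))
      = (\<Sum>i=1..r. scl (of_nat i) (X i (scl (1 / fact k) (pow_coeff X k (r - i) v))))" for k
  proof -
    have "scl (of_nat r) (scl (1 / fact (Suc k)) (pow_coeff X (Suc k) r v))
        = scl (1 / fact (Suc k)) (scl (of_nat r) (pow_coeff X (Suc k) r v))"
      by (simp add: mult.commute)
    also have "\<dots> = scl (1 / fact k) (\<Sum>i=1..r. scl (of_nat i) (X i (pow_coeff X k (r - i) v)))"
      by (subst pow_coeff_euler[OF assms]) (simp del: of_nat_Suc)
    finally show ?thesis
      by (simp add: latV.scale_sum_right module_hom.scale[OF lin] mult.commute)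
  qed
  \<comment> \<open>Powers beyond r - i vanish, so all coefficients with i >= 1 can be summed up to
    the same bound n = r - 1 and the two sums interchanged.\<close>
  have exp: "exp_coeff X (r - i) v = (\<Sum>k\<le>n. scl (1 / fact k) (pow_coeff X k (r - i) v))"
    if "i \<ge> 1" for i
    unfolding exp_coeff_def using that Suc
    by (intro sum.mono_neutral_left) (auto simp: pow_coeff_eq_0 module_hom.zero[OF lin])
  have "scl (of_nat r) (exp_coeff X r v)
      = (\<Sum>k\<le>n. scl (of_nat r) (scl (1 / fact (Suc k)) (pow_coeff X (Suc k) r v)))"
    \<comment> \<open>The zeroth power has no coefficient at r > 0, so only the shifted sum
      remains.\<close>
    unfolding exp_coeff_def Suc
    by (subst sum.atMost_Suc_shift) (simp add: latV.scale_right_distrib latV.scale_sum_right)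
  also have "\<dots> = (\<Sum>i=1..r. \<Sum>k\<le>n. scl (of_nat i) (X i (scl (1 / fact k) (pow_coeff X k (r - i) v))))"
    unfolding step by (rule sum.swap)
  also have "\<dots> = (\<Sum>i=1..r. scl (of_nat i) (X i (exp_coeff X (r - i) v)))"
    by (intro sum.cong refl) (simp add: exp latV.scale_sum_right module_hom.sum[OF lin])
  finally show ?thesis .
qed simp

section \<open>Bases by counting dimensions\<close>

lemma is_basis_family_bvec: "is_basis_family (case_prod bvec) UNIV"
  unfolding is_basis_family_def
proof (intro conjI)
  have lookup: "Poly_Mapping.lookup (case_prod bvec y) x = (if y = x then 1 else 0)" for x y
    by (simp add: bvec_def lookup_single when_def case_prod_unfold)
  show inj: "inj (case_prod bvec)"
  proof (rule injI)
    fix x y assume "case_prod bvec x = case_prod bvec y"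
    then have "Poly_Mapping.lookup (case_prod bvec y) x = 1"
      using lookup[of x x] by metis
    then show "x = y" unfolding lookup by (metis zero_neq_one)
  qed
  show "latV.independent (range (case_prod bvec))"
    unfolding latV.independent_explicit_finite_subsets
  proof (intro allI impI ballI)
    fix S u v
    assume S: "S \<subseteq> range (case_prod bvec)" "finite S" "(\<Sum>v\<in>S. scl (u v) v) = 0" and v: "v \<in> S"
    obtain x where x: "v = case_prod bvec x" using S(1) v by blast
    have "Poly_Mapping.lookup w x = (if w = v then 1 else 0)" if w: "w \<in> S" for w
    proof -
      obtain y where "w = case_prod bvec y" using S(1) w by blast
      then show ?thesis by (simp add: x lookup inj_eq[OF inj])
    qed
    then have "(\<Sum>w\<in>S. u w * Poly_Mapping.lookup w x) = (\<Sum>w\<in>S. if w = v then u w else 0)"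
      by (intro sum.cong) auto
    also have "\<dots> = u v" using S(2) v by simp
    also have "(\<Sum>w\<in>S. u w * Poly_Mapping.lookup w x)
        = Poly_Mapping.lookup (\<Sum>v\<in>S. scl (u v) v) x"
      by (simp only: lookup_sum lookup_scl)
    finally show "u v = 0" by (simp only: S(3) lookup_zero)
  qed
  have bvec: "bvec (fst x) (snd x) \<in> latV.span (range (case_prod bvec))" for x
    by (rule latV.span_base) (metis case_prod_conv rangeI prod.collapse)
  have "v \<in> latV.span (range (case_prod bvec))" for v
    by (subst latV_expand[of v]) (intro latV.span_sum latV.span_scale bvec)
  then show "latV.span (range (case_prod bvec)) = UNIV" by (simp add: set_eq_iff)
qed

text \<open>The blocks \<open>X x\<close> play the role of graded pieces. Within a finite union of
  blocks, \<open>f\<close> spans a space that contains as many independent vectors \<open>b\<close>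
  as there are indices, so neither a repetition nor a linear relation among the values of
  \<open>f\<close> is possible.\<close>

lemma is_basis_family_by_card:
  assumes b: "is_basis_family b I"
    and X: "\<And>x. x \<in> I \<Longrightarrow> finite (X x)" "\<And>x. x \<in> I \<Longrightarrow> x \<in> X x" "\<And>x. x \<in> I \<Longrightarrow> X x \<subseteq> I"
    and f: "\<And>x. x \<in> I \<Longrightarrow> b ` X x \<subseteq> latV.span (f ` X x)"
  shows "is_basis_family f I"
proof -
  have fin: "inj_on f T \<and> latV.independent (f ` T)"
    if T: "finite T" "T \<subseteq> I" "b ` T \<subseteq> latV.span (f ` T)" for T
  proof -
    have ind: "latV.independent (b ` T)"
      using b image_mono[OF T(2), of b] latV.independent_mono unfolding is_basis_family_def by metis
    have card: "card (b ` T) = card T"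
      using b inj_on_subset[OF _ T(2), of b] unfolding is_basis_family_def by (intro card_image) simp
    have bound: "card T \<le> card B" if "finite B" "f ` T \<subseteq> latV.span B" for B
    proof -
      have "b ` T \<subseteq> latV.span B"
        using T(3) latV.span_minimal[OF that(2) latV.subspace_span] by blast
      then show ?thesis
        using latV.independent_span_bound[OF that(1) ind] card by simp
    qed
    have le: "card T \<le> card (f ` T)"
      using T(1) by (intro bound latV.span_superset) simp
    then have inj: "inj_on f T"
      using T(1) card_image_le[of T f] by (simp add: eq_card_imp_inj_on)
    \<comment> \<open>Dropping a dependent vector would leave a spanning set with fewer than
      \<open>card T\<close> elements.\<close>
    moreover have "latV.independent (f ` T)"
    proof
      assume "latV.dependent (f ` T)"
      then obtain a where a: "a \<in> f ` T" "a \<in> latV.span (f ` T - {a})"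
        unfolding latV.dependent_def by blast
      have "f ` T \<subseteq> latV.span (f ` T - {a})"
        using a(2) latV.span_superset[of "f ` T - {a}"] by blast
      then have "card T \<le> card (f ` T - {a})" using T(1) by (intro bound) simp_all
      also have "\<dots> < card (f ` T)" using T(1) a(1) by (intro card_Diff1_less) simp_all
      also have "\<dots> \<le> card T" using T(1) by (rule card_image_le)
      finally show False by simp
    qed
    ultimately show ?thesis by blast
  qed
  \<comment> \<open>The spanning condition passes to unions of blocks, and injectivity and
    independence pass back to subsets.\<close>
  have cover: "inj_on f T \<and> latV.independent (f ` T)" if T: "finite T" "T \<subseteq> I" for T
  proof -
    let ?T = "\<Union>x\<in>T. X x"
    have "b y \<in> latV.span (f ` ?T)" if "x \<in> T" "y \<in> X x" for x y
    proof -
      have "b y \<in> latV.span (f ` X x)" using f[of x] T that by auto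
      moreover have "f ` X x \<subseteq> f ` ?T" using that by auto
      ultimately show ?thesis using latV.span_mono[of "f ` X x" "f ` ?T"] by (simp add: subset_eq)
    qed
    then have "b ` ?T \<subseteq> latV.span (f ` ?T)" by auto
    moreover have "finite ?T" using T X(1) by (intro finite_UN_I) auto
    moreover have "?T \<subseteq> I" using T(2) X(3) by blast
    ultimately have T': "inj_on f ?T" "latV.independent (f ` ?T)"
      using fin[of ?T] by auto
    have "T \<subseteq> ?T" using X(2) T(2) by blast
    then show ?thesis
      using inj_on_subset[OF T'(1)] latV.independent_mono[OF T'(2) image_mono] by simp
  qed
  have "inj_on f I"
  proof (rule inj_onI)
    fix x y assume "x \<in> I" "y \<in> I" and eq: "f x = f y"
    then have "inj_on f {x, y}" using cover[of "{x, y}", THEN conjunct1] by simp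
    from inj_onD[OF this eq] show "x = y" by simp
  qed
  moreover have "latV.independent (f ` I)"
  proof
    assume "latV.dependent (f ` I)"
    then obtain S u where S: "finite S" "S \<subseteq> f ` I" "\<exists>v\<in>S. u v \<noteq> 0" "(\<Sum>v\<in>S. scl (u v) v) = 0"
      unfolding latV.dependent_explicit by blast
    obtain T where T: "finite T" "T \<subseteq> I" "S = f ` T"
      using finite_subset_image[OF S(1,2)] by metis
    have "latV.independent S" unfolding T(3) using cover[OF T(1,2)] by (rule conjunct2)
    with S show False unfolding latV.dependent_explicit by blast
  qed
  moreover have "latV.span (f ` I) = UNIV"
  proof -
    have "b x \<in> latV.span (f ` I)" if "x \<in> I" for x
      using f[OF that] X(2)[OF that] latV.span_mono[OF image_mono[OF X(3)[OF that]], of f]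
      by (simp add: subset_eq)
    then have "latV.span (b ` I) \<subseteq> latV.span (f ` I)"
      by (intro latV.span_minimal latV.subspace_span) auto
    then show ?thesis using b by (simp add: is_basis_family_def set_eq_iff subset_eq)
  qed
  ultimately show ?thesis by (simp add: is_basis_family_def)
qed

text \<open>Equal values of \<open>g\<close> at \<open>p x\<close> and \<open>p y\<close> are equal
  values of \<open>f\<close>, so x = y; this gives injectivity on the image of
  \<open>p\<close>.\<close>

lemma is_basis_family_reindex:
  assumes f: "is_basis_family f I" and g: "\<And>x. x \<in> I \<Longrightarrow> g (p x) = f x" and p: "p ` I = J"
  shows "is_basis_family g J"
proof -
  have "g ` J = f ` I" unfolding p[symmetric] image_image using g by (intro image_cong) auto
  moreover have "inj_on g J"
    using f g unfolding p[symmetric] is_basis_family_def inj_on_def by auto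
  ultimately show ?thesis using f by (simp add: is_basis_family_def)
qed

section \<open>Creation operators on the graded pieces\<close>

lemma lin_op_comp: "lin_op S \<Longrightarrow> lin_op T \<Longrightarrow> lin_op (\<lambda>v. S (T v))"
  by (intro lin_opI) (simp_all add: module_hom.add module_hom.scale)

lemma subspace_lin_op_vimage:
  assumes "lin_op T" "latV.subspace U"
  shows "latV.subspace {v. T v \<in> U}"
  using assms(2)
  by (simp add: latV.subspace_def module_hom.add[OF assms(1)] module_hom.scale[OF assms(1)]
      module_hom.zero[OF assms(1)])

lemma lin_op_span:
  assumes "lin_op T" "\<And>v. v \<in> S \<Longrightarrow> T v \<in> latV.span U" "v \<in> latV.span S"
  shows "T v \<in> latV.span U"
proof -
  have "latV.span S \<subseteq> {v. T v \<in> latV.span U}"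
    using assms(2) by (intro latV.span_minimal subspace_lin_op_vimage assms(1) latV.subspace_span) auto
  then show ?thesis using assms(3) by blast
qed

text \<open>The argument 1 selects mu = sqrt M, the charge of both e(z) and theta(z).\<close>

definition creation :: "nat \<Rightarrow> nat \<Rightarrow> latV \<Rightarrow> latV" where
  "creation M r = exp_coeff (\<lambda>i. expo_term M 1 (- int i)) r"

definition annihilation :: "nat \<Rightarrow> nat \<Rightarrow> latV \<Rightarrow> latV" where
  "annihilation M s = exp_coeff (\<lambda>i. expo_term M 1 (int i)) s"

lemma creation_0 [simp]: "creation M 0 v = v"
  and annihilation_0 [simp]: "annihilation M 0 v = v"
  by (simp_all add: creation_def annihilation_def)

lemma lin_op_heis: "lin_op (heis M n)"
  unfolding heis_def by (rule lin_op_lin_ext)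

lemma lin_op_expo_term: "lin_op (expo_term M m n)"
  by (rule lin_opI)
    (simp_all add: expo_term_def heis_add heis_scl latV.scale_right_distrib mult.commute)

lemma lin_op_shift_q: "lin_op (shift_q m)"
  unfolding shift_q_def by (rule lin_op_lin_ext)

lemma lin_op_creation: "lin_op (creation M r)"
  unfolding creation_def by (intro lin_op_exp_coeff lin_op_expo_term)

lemma heis_neg_commute: "heis M (- int i) (heis M (- int l) v) = heis M (- int l) (heis M (- int i) v)"
proof (cases "i = l")
  case False
  then have "- int i + - int l \<noteq> 0" by linarith
  then show ?thesis using heis_commutator[of M "- int i" "- int l" v] by (simp only: if_False right_minus_eq)
qed simp

lemma expo_term_commute:
  "expo_term M m (- int i) (expo_term M m (- int l) v) = expo_term M m (- int l) (expo_term M m (- int i) v)"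
  by (simp add: expo_term_def heis_scl heis_neg_commute[of M i l] mult.commute)

lemma heis_creation_commute: "heis M (- int i) (creation M r v) = creation M r (heis M (- int i) v)"
  unfolding creation_def
  by (rule exp_coeff_commute[OF lin_op_heis])
    (simp add: expo_term_def heis_scl heis_neg_commute[of M i])

lemma creation_commute: "creation M r (creation M s v) = creation M s (creation M r v)"
  unfolding creation_def
proof (rule exp_coeff_commute)
  show "lin_op (exp_coeff (\<lambda>i. expo_term M 1 (- int i)) r)"
    by (intro lin_op_exp_coeff lin_op_expo_term)
  show "exp_coeff (\<lambda>i. expo_term M 1 (- int i)) r (expo_term M 1 (- int l) v)
      = expo_term M 1 (- int l) (exp_coeff (\<lambda>i. expo_term M 1 (- int i)) r v)" for l v
    by (rule exp_coeff_commute[symmetric]) (rule lin_op_expo_term expo_term_commute)+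
qed

lemma shift_q_bvec [simp]: "shift_q m (bvec j A) = bvec (j + m) A"
  by (simp add: shift_q_def)

lemma shift_q_shift_q: "shift_q m (shift_q k v) = shift_q (k + m) v"
  by (rule lin_op_eqI[OF lin_op_comp[OF lin_op_shift_q lin_op_shift_q] lin_op_shift_q])
    (simp add: add.assoc)

lemma shift_q_0: "shift_q 0 v = v"
  by (rule lin_op_eqI[OF lin_op_shift_q]) (auto intro: lin_opI)

text \<open>The zero mode is excluded because it reads off the charge, which \<open>shift_q\<close>
  changes.\<close>

lemma shift_q_heis:
  assumes "i > 0"
  shows "shift_q m (heis M (- int i) v) = heis M (- int i) (shift_q m v)"
  by (rule lin_op_eqI[OF lin_op_comp[OF lin_op_shift_q lin_op_heis] lin_op_comp[OF lin_op_heis lin_op_shift_q]])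
    (use assms in \<open>simp add: heis_bvec\<close>)

lemma shift_q_creation: "shift_q m (creation M r v) = creation M r (shift_q m v)"
  unfolding creation_def
proof (rule exp_coeff_commute[OF lin_op_shift_q])
  fix i v
  show "shift_q m (expo_term M 1 (- int i) v) = expo_term M 1 (- int i) (shift_q m v)"
    \<comment> \<open>The commutation rule asks for every index. At 0 the exponent term is zero
      because division by zero yields zero.\<close>
    by (cases "i = 0")
      (simp_all add: expo_term_def shift_q_heis module_hom.scale[OF lin_op_shift_q]
        module_hom.zero[OF lin_op_shift_q])
qed

text \<open>The exponent has coefficient sqrt M a_{-i} / i at w^i, so the weight i in Newton's
  identity cancels the denominator.\<close>

lemma creation_newton:
  "scl (of_nat r) (creation M r v)
    = scl (of_real (sqrt (real M))) (\<Sum>i=1..r. heis M (- int i) (creation M (r - i) v))"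
proof -
  have "scl (of_nat r) (creation M r v)
      = (\<Sum>i=1..r. scl (of_nat i) (expo_term M 1 (- int i) (creation M (r - i) v)))"
    unfolding creation_def by (rule exp_coeff_newton) (rule lin_op_expo_term expo_term_commute)+
  also have "\<dots> = (\<Sum>i=1..r. scl (of_real (sqrt (real M))) (heis M (- int i) (creation M (r - i) v)))"
    by (intro sum.cong refl) (simp add: expo_term_def)
  finally show ?thesis by (simp add: latV.scale_sum_right)
qed

section \<open>The grading by charge and degree\<close>

definition fock_grade :: "int \<Rightarrow> nat \<Rightarrow> latV set" where
  "fock_grade n d = {v. \<forall>j A. (j, A) \<in> Poly_Mapping.keys v \<longrightarrow> j = n \<and> wt A = d}"

lemma fock_grade_bvec: "bvec n A \<in> fock_grade n (wt A)"
  by (simp add: fock_grade_def)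

lemma subspace_fock_grade: "latV.subspace (fock_grade n d)"
  unfolding latV.subspace_def
proof (intro conjI ballI allI)
  fix u v c assume u: "u \<in> fock_grade n d" and v: "v \<in> fock_grade n d"
  show "u + v \<in> fock_grade n d"
    using u v Poly_Mapping.keys_add[of u v] unfolding fock_grade_def by blast
  show "scl c u \<in> fock_grade n d"
    using u by (simp add: fock_grade_def keys_scl)
qed (simp add: fock_grade_def)

lemma fock_grade_span: "fock_grade n d = latV.span (bvec n ` {A. wt A = d})"
proof
  show "fock_grade n d \<subseteq> latV.span (bvec n ` {A. wt A = d})"
  proof
    fix v assume v: "v \<in> fock_grade n d"
    have *: "bvec (fst x) (snd x) \<in> latV.span (bvec n ` {A. wt A = d})"
      if "x \<in> Poly_Mapping.keys v" for x
      using v that unfolding fock_grade_def by (cases x) (auto intro: latV.span_base)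
    show "v \<in> latV.span (bvec n ` {A. wt A = d})"
      by (subst latV_expand[of v]) (intro latV.span_sum latV.span_scale *)
  qed
  show "latV.span (bvec n ` {A. wt A = d}) \<subseteq> fock_grade n d"
    by (rule latV.span_minimal[OF _ subspace_fock_grade]) (auto simp: fock_grade_bvec)
qed

lemma homog_fock_grade:
  assumes "homog c T" "v \<in> fock_grade n d" "int d' = int d + c"
  shows "T v \<in> fock_grade n d'"
  using assms unfolding fock_grade_def homog_def by fastforce

lemma homog_fock_grade_neg:
  assumes "homog c T" "v \<in> fock_grade n d" "int d + c < 0"
  shows "T v = 0"
proof (rule ccontr)
  assume "T v \<noteq> 0"
  then obtain j B where B: "(j, B) \<in> Poly_Mapping.keys (T v)"
    by (metis all_not_in_conv keys_eq_empty surj_pair)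
  obtain A where "(j, A) \<in> Poly_Mapping.keys v" "int (wt B) = int (wt A) + c"
    using homogE[OF assms(1) B] .
  then show False using assms(2,3) by (auto simp: fock_grade_def)
qed

lemma creation_fock_grade: "v \<in> fock_grade n d \<Longrightarrow> creation M r v \<in> fock_grade n (d + r)"
  unfolding creation_def by (rule homog_fock_grade[OF homog_creation]) simp_all

lemma annihilation_fock_grade:
  "v \<in> fock_grade n d \<Longrightarrow> s \<le> d \<Longrightarrow> annihilation M s v \<in> fock_grade n (d - s)"
  unfolding annihilation_def by (rule homog_fock_grade[OF homog_annihilation]) (simp_all add: of_nat_diff)

lemma annihilation_eq_0: "v \<in> fock_grade n d \<Longrightarrow> d < s \<Longrightarrow> annihilation M s v = 0"
  unfolding annihilation_def by (rule homog_fock_grade_neg[OF homog_annihilation]) simp_all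

lemma shift_q_fock_grade:
  assumes "v \<in> fock_grade n d"
  shows "shift_q m v \<in> fock_grade (n + m) d"
  unfolding fock_grade_span
proof (rule lin_op_span[OF lin_op_shift_q])
  show "v \<in> latV.span (bvec n ` {A. wt A = d})" using assms by (simp add: fock_grade_span)
qed (auto intro: latV.span_base)

lemma heis_fock_grade: "v \<in> fock_grade n d \<Longrightarrow> r > 0 \<Longrightarrow> heis M (- int r) v \<in> fock_grade n (d + r)"
  by (rule homog_fock_grade[OF homog_heis]) simp_all

lemma zpow_coeff_fock_grade:
  assumes "v \<in> fock_grade n d"
  shows "zpow_coeff M m p v = (if m * n * int M = p then v else 0)"
proof -
  have lin: "lin_op (zpow_coeff M m p)" unfolding zpow_coeff_def by (rule lin_op_lin_ext)
  have lin': "lin_op (\<lambda>v. if m * n * int M = p then v else 0)" by (rule lin_opI) auto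
  interpret vector_space_pair scl scl by unfold_locales
  show ?thesis
    by (rule linear_eq_on_span[OF lin[unfolded module_hom_iff_linear] lin'[unfolded module_hom_iff_linear], of "bvec n ` {A. wt A = d}"])
      (use assms in \<open>auto simp: fock_grade_span zpow_coeff_def\<close>)
qed

text \<open>On charge n the factor z^(mu a_0) contributes exactly z^(nM), which forces the creation
  index to be r + s; annihilation beyond degree d gives zero.\<close>

lemma vop_coeff_fock_grade:
  assumes v: "v \<in> fock_grade n d"
  shows "vop_coeff M 1 (n * int M + int r) v
    = (\<Sum>s\<le>d. shift_q 1 (creation M (r + s) (annihilation M s v)))"
proof -
  let ?p = "n * int M + int r"
  let ?g = "\<lambda>(q, s). shift_q 1 (zpow_coeff M 1 (?p - int q + int s) (creation M q (annihilation M s v)))"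
  have g: "?g (q, s) = (if s \<le> d \<and> q = r + s
      then shift_q 1 (creation M (r + s) (annihilation M s v)) else 0)" for q s
  proof (cases "s \<le> d")
    case True
    have "creation M q (annihilation M s v) \<in> fock_grade n (d - s + q)"
      using v True by (intro creation_fock_grade annihilation_fock_grade)
    then show ?thesis
      using True by (auto simp: zpow_coeff_fock_grade module_hom.zero[OF lin_op_shift_q])
  next
    case False
    then show ?thesis
      using v by (simp add: annihilation_eq_0 module_hom.zero[OF lin_op_shift_q]
          module_hom.zero[OF lin_op_creation] zpow_coeff_def)
  qed
  have supp: "{x. ?g x \<noteq> 0} \<subseteq> (\<lambda>s. (r + s, s)) ` {..d}"
  proof
    fix x assume "x \<in> {x. ?g x \<noteq> 0}"
    then have "?g (fst x, snd x) \<noteq> 0" unfolding prod.collapse by (rule CollectD)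
    then have "snd x \<le> d \<and> fst x = r + snd x" unfolding g by (rule contrapos_np) (rule if_not_P)
    then show "x \<in> (\<lambda>s. (r + s, s)) ` {..d}"
      by (intro image_eqI[of _ _ "snd x"]) (simp_all add: prod_eq_iff)
  qed
  have "vop_coeff M 1 ?p v = Sum_any ?g"
    by (simp add: vop_coeff_def creation_def annihilation_def)
  also have "\<dots> = sum ?g ((\<lambda>s. (r + s, s)) ` {..d})"
    by (rule Sum_any.expand_superset[OF _ supp]) simp
  also have "\<dots> = (\<Sum>s\<le>d. ?g (r + s, s))"
    by (subst sum.reindex) (auto intro: inj_onI)
  also have "\<dots> = (\<Sum>s\<le>d. shift_q 1 (creation M (r + s) (annihilation M s v)))"
    unfolding g by (intro sum.cong) auto
  finally show ?thesis .
qed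

section \<open>Spanning by triangularity\<close>

text \<open>A filtration of the piece of charge n and degree d, decreasing in r and zero for r > d.
  It carries the downward induction.\<close>

definition creation_span :: "nat \<Rightarrow> int \<Rightarrow> nat \<Rightarrow> nat \<Rightarrow> latV set" where
  "creation_span M n d r = latV.span {creation M s w | s e w. r \<le> s \<and> e + s = d \<and> w \<in> fock_grade n e}"

lemma creation_spanI:
  "w \<in> fock_grade n e \<Longrightarrow> r \<le> s \<Longrightarrow> e + s = d \<Longrightarrow> creation M s w \<in> creation_span M n d r"
  unfolding creation_span_def by (rule latV.span_base) blast

lemma creation_span_antimono: "r \<le> r' \<Longrightarrow> creation_span M n d r' \<subseteq> creation_span M n d r"
  unfolding creation_span_def by (rule latV.span_mono) (auto dest: order_trans)

lemma creation_span_fock_grade: "creation_span M n d r \<subseteq> fock_grade n d"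
  unfolding creation_span_def
  by (rule latV.span_minimal[OF _ subspace_fock_grade]) (auto intro: creation_fock_grade)

text \<open>Newton's identity is solved for its term i = r. In the terms with 0 < i < r the factor
  a_{-i} is commuted past the creation operator, which leaves images of operators of positive
  index.\<close>

lemma heis_in_creation_span:
  assumes M: "M > 0" and r: "r > 0" and w: "w \<in> fock_grade n e"
  shows "heis M (- int r) w \<in> creation_span M n (e + r) 1"
proof -
  let ?S = "creation_span M n (e + r) 1"
  let ?c = "of_real (sqrt (real M)) :: complex"
  let ?h = "\<lambda>i. heis M (- int i) (creation M (r - i) w)"
  note sub = latV.subspace_span[of "{creation M s w' | s e' w'. 1 \<le> s \<and> e' + s = e + r \<and> w' \<in> fock_grade n e'}",
      folded creation_span_def]
  have lower: "?h i \<in> ?S" if "i \<in> {1..<r}" for i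
    unfolding heis_creation_commute
    using that w by (intro creation_spanI[of _ _ "e + i"] heis_fock_grade) auto
  have "scl (of_nat r) (creation M r w) \<in> ?S"
    using w r by (intro latV.subspace_scale[OF sub] creation_spanI) auto
  moreover have "scl ?c (\<Sum>i\<in>{1..<r}. ?h i) \<in> ?S"
    using lower by (intro latV.subspace_scale[OF sub] latV.subspace_sum[OF sub])
  moreover have "{1..r} = insert r {1..<r}" using r by auto
  then have "scl ?c (heis M (- int r) w)
      = scl (of_nat r) (creation M r w) - scl ?c (\<Sum>i\<in>{1..<r}. ?h i)"
    by (simp add: creation_newton latV.scale_right_distrib)
  ultimately have "scl ?c (heis M (- int r) w) \<in> ?S"
    using latV.subspace_diff[OF sub] by simp
  \<comment> \<open>Here M > 0 makes sqrt M invertible.\<close>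
  then have "scl (1 / ?c) (scl ?c (heis M (- int r) w)) \<in> ?S"
    by (rule latV.subspace_scale[OF sub])
  then show ?thesis using M by simp
qed

text \<open>A monomial of positive degree has a factor a_{-r} with r >= 1, and
  \<open>heis_in_creation_span\<close> applies to it.\<close>

lemma fock_grade_eq_creation_span:
  assumes "M > 0" "d > 0"
  shows "fock_grade n d = creation_span M n d 1"
proof
  have "bvec n A \<in> creation_span M n d 1" if A: "wt A = d" for A
  proof -
    have "A \<noteq> {#}" using A assms(2) by (auto simp: wt_def)
    then obtain i B where B: "A = add_mset i B" by (metis multiset_cases)
    have "bvec n A = heis M (- int (Suc i)) (bvec n B)" by (simp add: B heis_bvec nat_add_distrib)
    also have "\<dots> \<in> creation_span M n (wt B + Suc i) 1"
      using assms(1) by (intro heis_in_creation_span fock_grade_bvec) auto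
    also have "wt B + Suc i = d" using A by (simp add: B wt_def)
    finally show ?thesis .
  qed
  then show "fock_grade n d \<subseteq> creation_span M n d 1"
    unfolding fock_grade_span
    by (intro latV.span_minimal) (auto simp: creation_span_def intro: latV.subspace_span)
qed (rule creation_span_fock_grade)

text \<open>The subtracted vector is the term s = 0 of the expansion; in every other term the
  creation index r + s exceeds r.\<close>

lemma vop_coeff_triangular:
  assumes v: "v \<in> fock_grade n e"
  shows "vop_coeff M 1 (n * int M + int r) v - shift_q 1 (creation M r v)
    \<in> creation_span M (n + 1) (e + r) (Suc r)"
proof -
  have "{..e} = insert 0 {1..e}" by auto
  then have "vop_coeff M 1 (n * int M + int r) v - shift_q 1 (creation M r v)
      = (\<Sum>s=1..e. creation M (r + s) (shift_q 1 (annihilation M s v)))"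
    by (simp add: vop_coeff_fock_grade[OF v] shift_q_creation)
  also have "\<dots> \<in> creation_span M (n + 1) (e + r) (Suc r)"
    unfolding creation_span_def
  proof (intro latV.span_sum creation_spanI[unfolded creation_span_def])
    fix s assume s: "s \<in> {1..e}"
    then show "shift_q 1 (annihilation M s v) \<in> fock_grade (n + 1) (e - s)"
      using v by (intro shift_q_fock_grade annihilation_fock_grade) auto
    show "Suc r \<le> r + s" "e - s + (r + s) = e + r" using s by auto
  qed
  finally show ?thesis .
qed

lemma vop_coeff_in_creation_span:
  assumes v: "v \<in> fock_grade n e"
  shows "vop_coeff M 1 (n * int M + int r) v \<in> creation_span M (n + 1) (e + r) r"
proof -
  have "shift_q 1 (creation M r v) \<in> creation_span M (n + 1) (e + r) r"
    unfolding shift_q_creation using v by (intro creation_spanI shift_q_fock_grade) auto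
  moreover have "vop_coeff M 1 (n * int M + int r) v - shift_q 1 (creation M r v)
      \<in> creation_span M (n + 1) (e + r) r"
    by (rule subsetD[OF creation_span_antimono vop_coeff_triangular[OF v]]) simp
  ultimately show ?thesis
    unfolding creation_span_def using latV.span_add by fastforce
qed

text \<open>
  The monomial attached to a charge \<open>n\<close> and a partition \<open>\<lambda>\<^sub>1 \<ge> \<lambda>\<^sub>2 \<ge> \<dots>\<close>: the \<open>i\<close>-th factor is the
  coefficient of \<open>z\<close> to the power \<open>(n - i) M + \<lambda>\<^sub>i\<close>, so that vanishing parts only raise the charge
  of the vacuum.
\<close>

fun part_vec :: "nat \<Rightarrow> int \<Rightarrow> nat list \<Rightarrow> latV" where
  "part_vec M n [] = vac n"
| "part_vec M n (l # ls) = vop_coeff M 1 ((n - 1) * int M + int l) (part_vec M (n - 1) ls)"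

definition partitions :: "nat \<Rightarrow> nat list set" where
  "partitions d = {ls. sorted_wrt (\<ge>) ls \<and> 0 \<notin> set ls \<and> sum_list ls = d}"

text \<open>Measuring the exponent of z relative to (n - 1) M makes a factor with part l raise the
  degree by exactly l.\<close>

lemma part_vec_fock_grade: "part_vec M n ls \<in> fock_grade n (sum_list ls)"
proof (induction ls arbitrary: n)
  case Nil
  show ?case using fock_grade_bvec[of n "{#}"] by (simp add: vac_def wt_def)
next
  case (Cons l ls)
  show ?case
    using subsetD[OF creation_span_fock_grade vop_coeff_in_creation_span[OF Cons.IH[of "n - 1"], of M l]]
    by (simp add: add.commute)
qed

lemma part_vec_in_creation_span:
  "part_vec M n (l # ls) \<in> creation_span M n (sum_list (l # ls)) l"
  using vop_coeff_in_creation_span[OF part_vec_fock_grade[of M "n - 1" ls], of M l]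
  by (simp add: add.commute)

text \<open>Creation operators commute with each other and with the charge shift, so a further one
  raises the degree without lowering the filtration index.\<close>

lemma shift_q_creation_span:
  assumes "v \<in> creation_span M n e r"
  shows "shift_q 1 (creation M k v) \<in> creation_span M (n + 1) (e + k) r"
  unfolding creation_span_def
proof (rule lin_op_span[OF lin_op_comp[OF lin_op_shift_q lin_op_creation]])
  show "v \<in> latV.span {creation M s w | s e' w. r \<le> s \<and> e' + s = e \<and> w \<in> fock_grade n e'}"
    using assms by (simp add: creation_span_def)
  fix u assume "u \<in> {creation M s w | s e' w. r \<le> s \<and> e' + s = e \<and> w \<in> fock_grade n e'}"
  then obtain s e' w where u: "u = creation M s w" "r \<le> s" "e' + s = e" "w \<in> fock_grade n e'"
    by blast
  have "shift_q 1 (creation M k u) = creation M s (shift_q 1 (creation M k w))"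
    by (simp add: u(1) creation_commute[of M k s] shift_q_creation)
  also have "\<dots> \<in> creation_span M (n + 1) (e + k) r"
    using u by (intro creation_spanI[of _ _ "e' + k"] shift_q_fock_grade creation_fock_grade) auto
  finally show "shift_q 1 (creation M k u) \<in> latV.span {creation M s w | s e' w. r \<le> s
      \<and> e' + s = e + k \<and> w \<in> fock_grade (n + 1) e'}"
    by (simp add: creation_span_def)
qed

lemma partitions_0: "[] \<in> partitions 0"
  by (simp add: partitions_def)

lemma fock_grade_subset_part_span:
  assumes M: "M > 0"
  shows "fock_grade n d \<subseteq> latV.span (part_vec M n ` partitions d)"
proof (induction d arbitrary: n rule: less_induct)
  case (less d)
  let ?P = "latV.span (part_vec M n ` partitions d)"
  show ?case
  proof (cases "d = 0")
    case True
    have "wt A = 0 \<longleftrightarrow> A = {#}" for A by (auto simp: wt_def)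
    then have "bvec n ` {A. wt A = 0} = {vac n}" by (auto simp: vac_def)
    moreover have "vac n \<in> part_vec M n ` partitions 0"
      using partitions_0 by (intro image_eqI[of _ _ "[]"]) simp_all
    ultimately show ?thesis
      unfolding True fock_grade_span by (intro latV.span_mono) auto
  next
    case False
    have step: "creation_span M n d r \<subseteq> ?P"
      if r: "r \<ge> 1" and higher: "creation_span M n d (Suc r) \<subseteq> ?P" for r
      unfolding creation_span_def
    proof (rule latV.span_minimal[OF _ latV.subspace_span], safe)
      fix s e w assume s: "r \<le> s" and d: "d = e + s" and w: "w \<in> fock_grade n e"
      show "creation M s w \<in> latV.span (part_vec M n ` partitions (e + s))"
      proof (cases "s = r")
        case False
        then show ?thesis
          using creation_spanI[OF w, of "Suc r" s d M] s d higher by auto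
      next
        case True
        note d = d[unfolded True]
        have part: "shift_q 1 (creation M r u) \<in> ?P" if u: "u \<in> part_vec M (n - 1) ` partitions e" for u
        proof -
          obtain ls where ls: "u = part_vec M (n - 1) ls" "ls \<in> partitions e" using u by blast
          have sum: "sum_list ls = e" using ls(2) by (simp add: partitions_def)
          have grade: "u \<in> fock_grade (n - 1) e"
            using part_vec_fock_grade[of M "n - 1" ls] by (simp add: ls(1) sum)
          show ?thesis
          \<comment> \<open>If r can be prepended, the new monomial has leading term C_r u and the
            error lies deeper in the filtration.\<close>
          proof (cases "r # ls \<in> partitions d")
            case True
            then have "part_vec M n (r # ls) \<in> ?P" by (intro latV.span_base imageI)
            moreover have "part_vec M n (r # ls) - shift_q 1 (creation M r u) \<in> ?P"
              using vop_coeff_triangular[OF grade, of M r] higher by (auto simp: ls(1) d)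
            ultimately have "part_vec M n (r # ls) - (part_vec M n (r # ls) - shift_q 1 (creation M r u)) \<in> ?P"
              by (rule latV.span_diff)
            then show ?thesis by simp
          next
            case False
            \<comment> \<open>Only the order can fail, so the first part l exceeds r. Then u already
              lies in filtration step l, and commuting C_r inward keeps it beyond r.\<close>
            then obtain l ls' where l: "ls = l # ls'" "r < l"
              using ls(2) r d by (cases ls) (auto simp: partitions_def not_le dest: order_trans)
            have "u \<in> creation_span M (n - 1) e l"
              using part_vec_in_creation_span[of M "n - 1" l ls'] sum by (simp add: ls(1) l(1))
            then have "u \<in> creation_span M (n - 1) e (Suc r)"
              using creation_span_antimono[of "Suc r" l] l(2) by auto
            from shift_q_creation_span[OF this, of r] show ?thesis
              using higher by (auto simp: d)
          qed
        qed
        \<comment> \<open>Lowering the charge by one brings w to degree e < d and charge n - 1,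
          where the outer induction hypothesis expresses it by monomials u.\<close>
        have "shift_q (- 1) w \<in> latV.span (part_vec M (n - 1) ` partitions e)"
          using less.IH[of e "n - 1"] shift_q_fock_grade[OF w, of "- 1"] d r by auto
        with part have "shift_q 1 (creation M r (shift_q (- 1) w)) \<in> ?P"
          by (rule lin_op_span[OF lin_op_comp[OF lin_op_shift_q lin_op_creation]])
        then show ?thesis
          by (simp add: True d shift_q_creation shift_q_shift_q shift_q_0)
      qed
    qed
    \<comment> \<open>The downward induction runs from index d + 1, where the filtration is zero, to
      index 1, where it is the whole piece.\<close>
    have "creation_span M n d (Suc d - k) \<subseteq> ?P" if "k \<le> d" for k
      using that
    proof (induction k)
      case 0
      have "creation_span M n d (Suc d) = {0}"
        unfolding creation_span_def by (subst latV.span_empty[symmetric], rule arg_cong[of _ _ latV.span]) auto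
      then show ?case by (simp add: latV.span_zero)
    next
      case (Suc k)
      then show ?case using step[of "Suc d - Suc k"] by (simp add: Suc_diff_le)
    qed
    from this[of d] show ?thesis
      using fock_grade_eq_creation_span[OF M] False by simp
  qed
qed

section \<open>Partitions as multisets\<close>

definition parts :: "nat multiset \<Rightarrow> nat list" where
  "parts A = rev (sorted_list_of_multiset (image_mset Suc A))"

text \<open>The \<open>Suc\<close> in \<open>parts\<close> undoes the encoding of a_{-(i+1)} by i:
  parts are positive and their sum is the degree.\<close>

lemma parts_in_partitions: "parts A \<in> partitions (wt A)"
proof -
  have "sum_list (parts A) = sum_mset (mset (parts A))" by (rule sum_mset_sum_list[symmetric])
  then have "sum_list (parts A) = wt A" by (simp add: parts_def wt_def)
  then show ?thesis
    using sorted_sorted_list_of_multiset[of "image_mset Suc A"]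
    by (auto simp: partitions_def parts_def sorted_wrt_rev)
qed

lemma partitions_eq_parts:
  assumes "ls \<in> partitions d"
  obtains A where "wt A = d" "ls = parts A"
proof -
  define A where "A = image_mset (\<lambda>x. x - 1) (mset ls)"
  have "image_mset Suc A = image_mset (\<lambda>x. x) (mset ls)"
    unfolding A_def multiset.map_comp
    using assms by (intro image_mset_cong) (auto simp: partitions_def intro!: Suc_pred gr0I)
  then have "parts A = rev (sort ls)" by (simp add: parts_def)
  also have "sort ls = rev ls"
    using assms by (intro properties_for_sort) (auto simp: partitions_def sorted_wrt_rev)
  finally have ls: "ls = parts A" by simp
  moreover have "wt A = d"
    using parts_in_partitions[of A] assms unfolding ls[symmetric] by (simp add: partitions_def)
  ultimately show ?thesis by (rule that[rotated])
qed

lemma finite_wt: "finite {A. wt A = d}"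
proof (rule finite_subset)
  show "{A. wt A = d} \<subseteq> mset ` {xs. set xs \<subseteq> {..d} \<and> length xs \<le> d}"
  proof
    fix A assume A: "A \<in> {A. wt A = d}"
    obtain xs where xs: "A = mset xs" by (metis ex_mset)
    have d: "d = (\<Sum>x\<leftarrow>xs. Suc x)"
      using A by (simp add: wt_def xs sum_mset_sum_list flip: mset_map)
    have "Suc x \<le> d" if "x \<in> set xs" for x
      unfolding d using that by (intro member_le_sum_list) auto
    moreover have "length xs \<le> d" unfolding d by (induction xs) auto
    ultimately show "A \<in> mset ` {xs. set xs \<subseteq> {..d} \<and> length xs \<le> d}"
      unfolding xs by (intro imageI) (auto intro: Suc_leD)
  qed
  show "finite (mset ` {xs. set xs \<subseteq> {..d} \<and> length xs \<le> d})"
    by (intro finite_imageI finite_lists_length_le) simp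
qed

text \<open>The blocks are the index sets of the graded pieces. Both families carry the same
  indices, so the equality of dimension and number of partitions is built into the indexing.\<close>

theorem is_basis_family_part_vec:
  assumes "M > 0"
  shows "is_basis_family (\<lambda>(n, A). part_vec M n (parts A)) UNIV"
proof (rule is_basis_family_by_card[OF is_basis_family_bvec])
  let ?X = "\<lambda>x :: int \<times> nat multiset. {fst x} \<times> {B. wt B = wt (snd x)}"
  let ?f = "\<lambda>(n, A). part_vec M n (parts A)"
  fix x :: "int \<times> nat multiset"
  show "finite (?X x)" using finite_wt by simp
  show "x \<in> ?X x" by (cases x) simp
  show "case_prod bvec ` ?X x \<subseteq> latV.span (?f ` ?X x)"
  proof
    fix v assume "v \<in> case_prod bvec ` ?X x"
    then have "v \<in> fock_grade (fst x) (wt (snd x))"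
      by clarsimp (metis fock_grade_bvec)
    then have v: "v \<in> latV.span (part_vec M (fst x) ` partitions (wt (snd x)))"
      using fock_grade_subset_part_span[OF assms] by blast
    have "part_vec M (fst x) ` partitions (wt (snd x)) \<subseteq> ?f ` ?X x"
    proof
      fix u assume "u \<in> part_vec M (fst x) ` partitions (wt (snd x))"
      then obtain ls where ls: "u = part_vec M (fst x) ls" "ls \<in> partitions (wt (snd x))" by blast
      then obtain A where "wt A = wt (snd x)" "ls = parts A" by (elim partitions_eq_parts)
      then show "u \<in> ?f ` ?X x" using ls(1) by (intro image_eqI[of _ _ "(fst x, A)"]) auto
    qed
    then show "v \<in> latV.span (?f ` ?X x)" using v by (rule subsetD[OF latV.span_mono])
  qed
qed simp

section \<open>Fibonacci configurations and partitions\<close>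

text \<open>
  \<open>fib_pos M c n ls\<close> enumerates, from index \<open>0\<close>, the modes occurring in the monomial of charge \<open>n\<close>
  and partition \<open>ls\<close>; the offset \<open>c\<close> accounts for the conventions for the modes:
  \<open>e\<^sub>m\<close> is the coefficient of \<open>z\<^bsup>-m-N\<^esup>\<close> (\<open>c = N\<close>), \<open>\<theta>\<^sub>m\<close> that of \<open>z\<^bsup>-m\<^esup>\<close> (\<open>c = 0\<close>).
\<close>

definition fib_pos :: "nat \<Rightarrow> nat \<Rightarrow> int \<Rightarrow> nat list \<Rightarrow> nat \<Rightarrow> int" where
  "fib_pos M c n ls i = (int i + 1 - n) * int M - int c - (if i < length ls then int (ls ! i) else 0)"

definition fib_conf :: "nat \<Rightarrow> nat \<Rightarrow> int \<Rightarrow> nat list \<Rightarrow> int \<Rightarrow> nat" where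
  "fib_conf M c n ls j = (if - j \<in> range (fib_pos M c n ls) then 1 else 0)"

lemma fib_pos_tail: "length ls \<le> i \<Longrightarrow> fib_pos M c n ls i = (int i + 1 - n) * int M - int c"
  by (simp add: fib_pos_def)

text \<open>The parts are subtracted and nonincreasing, so they can only widen the gaps M of the
  densest configuration.\<close>

lemma fib_pos_Suc:
  assumes "sorted_wrt (\<ge>) ls"
  shows "fib_pos M c n ls i + int M \<le> fib_pos M c n ls (Suc i)"
proof -
  have "Suc i < length ls \<Longrightarrow> ls ! Suc i \<le> ls ! i"
    by (intro sorted_wrt_nth_less[OF assms]) simp_all
  then show ?thesis by (auto simp: fib_pos_def algebra_simps)
qed

lemma strict_mono_fib_pos: "M > 0 \<Longrightarrow> sorted_wrt (\<ge>) ls \<Longrightarrow> strict_mono (fib_pos M c n ls)"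
  unfolding strict_mono_Suc_iff
proof
  fix i assume "M > 0" "sorted_wrt (\<ge>) ls"
  then show "fib_pos M c n ls i < fib_pos M c n ls (Suc i)"
    using fib_pos_Suc[of ls M c n i] by simp
qed

lemma fib_pos_gap:
  assumes "M > 0" "sorted_wrt (\<ge>) ls" "i < k"
  shows "fib_pos M c n ls i + int M \<le> fib_pos M c n ls k"
  using fib_pos_Suc[OF assms(2), of M c n i] strict_mono_less_eq[OF strict_mono_fib_pos[OF assms(1,2)], of c n "Suc i" k]
    assms(3) by simp

text \<open>A window sum counts ones; this form of the Fibonacci condition can be compared with gaps
  between positions.\<close>

lemma sum_window_le_1_iff:
  fixes a :: "int \<Rightarrow> nat"
  assumes "\<And>i. a i \<in> {0, 1}"
  shows "(\<Sum>k=0..l. a (i + int k)) \<le> 1 \<longleftrightarrow>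
    (\<forall>x\<in>{0..l}. \<forall>y\<in>{0..l}. a (i + int x) = 1 \<longrightarrow> a (i + int y) = 1 \<longrightarrow> x = y)"
proof -
  have "(\<Sum>k=0..l. a (i + int k)) = (\<Sum>k=0..l. if a (i + int k) = 1 then 1 else 0)"
    using assms by (intro sum.cong) auto
  also have "\<dots> = card {k \<in> {0..l}. a (i + int k) = 1}"
    by (simp add: sum.If_cases Int_def)
  finally have eq: "(\<Sum>k=0..l. a (i + int k)) = card {k \<in> {0..l}. a (i + int k) = 1}" .
  have "card K \<le> 1 \<longleftrightarrow> (\<forall>x\<in>K. \<forall>y\<in>K. x = y)" if "finite K" for K :: "nat set"
    using card_le_Suc0_iff_eq[OF that] by simp
  then show ?thesis unfolding eq by (simp add: Ball_def imp_conjL)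
qed

lemma fib_conf_in_Fib_inf:
  assumes M: "M > 0" and ls: "sorted_wrt (\<ge>) ls"
  shows "fib_conf M c n ls \<in> Fib_inf c (M - 1)"
proof -
  let ?a = "fib_conf M c n ls" and ?p = "fib_pos M c n ls"
  have a01: "?a i \<in> {0, 1}" for i by (simp add: fib_conf_def)
  have a1: "?a j = 1 \<longleftrightarrow> - j \<in> range ?p" for j by (simp add: fib_conf_def)
  note mono = strict_mono_fib_pos[OF M ls, of c n]
  have window: "(\<Sum>k=0..M-1. ?a (i + int k)) \<le> 1" for i
    unfolding sum_window_le_1_iff[of ?a, OF a01]
  proof (intro ballI impI)
    fix x y assume x: "x \<in> {0..M-1}" "?a (i + int x) = 1" and y: "y \<in> {0..M-1}" "?a (i + int y) = 1"
    obtain u v where u: "- (i + int x) = ?p u" and v: "- (i + int y) = ?p v"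
      using x(2) y(2) unfolding a1 by blast
    \<comment> \<open>Offsets in the window differ by less than M, whereas distinct positions differ
      by at least M.\<close>
    have "\<not> u < v" "\<not> v < u"
      using fib_pos_gap[OF M ls, of u v c n] fib_pos_gap[OF M ls, of v u c n] u v x(1) y(1) M
      by auto
    then have "u = v" by simp
    then show "x = y" using u v by simp
  qed
  have zero: "?a i = 0" if "i \<ge> 1 - ?p 0" for i
  proof -
    have "?p 0 \<le> ?p k" for k using mono by (simp add: strict_mono_less_eq)
    then have "- i \<noteq> ?p k" for k using that by (smt (verit))
    then show ?thesis by (auto simp: fib_conf_def)
  qed
  have tail: "?a (- m) = (if [- m = int c] (mod (int (M - 1) + 1)) then 1 else 0)"
    if m: "m \<ge> ?p (length ls)" for m
  proof -
    have "m \<in> range ?p \<longleftrightarrow> int M dvd - m - int c"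
    proof
      assume "m \<in> range ?p"
      then obtain k where k: "m = ?p k" by blast
      with m mono have "length ls \<le> k" by (simp add: strict_mono_less_eq)
      then have "- m - int c = int M * (n - int k - 1)"
        using k by (simp add: fib_pos_tail algebra_simps)
      then show "int M dvd - m - int c" by simp
    next
      assume "int M dvd - m - int c"
      then obtain q where q: "- m - int c = int M * q" by (rule dvdE)
      have "int M * (int (length ls) + 1 - n) \<le> int M * (- q)"
        using m q by (simp add: fib_pos_tail algebra_simps)
      then have "int (length ls) + 1 - n \<le> - q" using M by (subst (asm) mult_le_cancel_left_pos) simp_all
      then have le: "int (length ls) \<le> n - 1 - q" by simp
      \<comment> \<open>The index solves (k + 1 - n) M - c = m; the bound on m places it past the
        last part.\<close>
      then have "?p (nat (n - 1 - q)) = m"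
        using q by (subst fib_pos_tail) (auto simp: algebra_simps)
      then show "m \<in> range ?p" by (metis rangeI)
    qed
    moreover have "int (M - 1) + 1 = int M" using M by simp
    ultimately show ?thesis by (simp add: fib_conf_def cong_iff_dvd_diff)
  qed
  show ?thesis unfolding Fib_inf_def using a01 window zero tail by blast
qed

lemma tau_fib_conf:
  assumes "M > 0" "sorted_wrt (\<ge>) ls"
  shows "tau (fib_conf M c n ls) (Suc i) = fib_pos M c n ls i"
proof -
  let ?p = "fib_pos M c n ls"
  note mono = strict_mono_fib_pos[OF assms, of c n]
  have "{- j | j. fib_conf M c n ls j = 1} = range ?p"
  proof (intro set_eqI iffI)
    fix x assume "x \<in> range ?p"
    then show "x \<in> {- j | j. fib_conf M c n ls j = 1}"
      by (intro CollectI exI[of _ "- x"]) (simp add: fib_conf_def)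
  qed (auto simp: fib_conf_def split: if_splits)
  moreover have "increasing_enum (range ?p) = ?p"
    unfolding increasing_enum_def
    using mono by (intro the_equality) (auto intro: strict_mono_range_unique)
  ultimately show ?thesis by (simp add: tau_def)
qed

section \<open>From configurations back to partitions\<close>

lemma Fib_inf_enum:
  assumes M: "M > 0" and a: "a \<in> Fib_inf c (M - 1)"
  defines "f \<equiv> increasing_enum {- j | j. a j = 1}"
  shows "range f = {- j | j. a j = 1}" "f i + int M \<le> f (Suc i)"
proof -
  let ?S = "{- j | j. a j = 1}"
  have S: "t \<in> ?S \<longleftrightarrow> a (- t) = 1" for t
    by (auto intro: exI[of _ "- t"])
  have a01: "a i \<in> {0, 1}" for i using a by (simp add: Fib_inf_def)
  obtain i0 where i0: "\<And>i. i \<ge> i0 \<Longrightarrow> a i = 0" using a unfolding Fib_inf_def by blast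
  obtain n0 where n0: "\<And>n. n \<ge> n0 \<Longrightarrow>
      a (- n) = (if [- n = int c] (mod (int (M - 1) + 1)) then 1 else 0)"
    using a unfolding Fib_inf_def by blast
  have lower: "- i0 \<le> t" if "t \<in> ?S" for t
    using i0[of "- t"] S[of t] that by (cases "i0 \<le> - t") auto
  have "infinite ?S"
  proof
    assume fin: "finite ?S"
    \<comment> \<open>The prescribed periodic tail already supplies infinitely many ones.\<close>
    let ?g = "\<lambda>k. int M * int k - int c"
    have "?g k \<in> ?S" if "k \<ge> nat (n0 + int c)" for k
    proof -
      have "int k \<le> int M * int k" using M by (simp add: mult_le_cancel_right1)
      then have "?g k \<ge> n0" using that by linarith
      moreover have "[- ?g k = int c] (mod (int (M - 1) + 1))"
        using M by (simp add: cong_iff_dvd_diff)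
      ultimately have "a (- ?g k) = 1" using n0[of "?g k"] by (simp only: if_True)
      then show ?thesis by (simp only: S)
    qed
    then have "?g ` {nat (n0 + int c)..} \<subseteq> ?S" by blast
    then have "finite (?g ` {nat (n0 + int c)..})" using fin by (rule finite_subset)
    moreover have "inj_on ?g {nat (n0 + int c)..}" using M by (auto intro!: inj_onI)
    ultimately have "finite {nat (n0 + int c)..}" by (rule finite_imageD)
    then show False by (simp add: infinite_Ici)
  qed
  note f = increasing_enum[OF this lower, folded f_def]
  show "range f = ?S" by (rule f(2))
  show "f i + int M \<le> f (Suc i)"
  proof (rule ccontr)
    assume "\<not> f i + int M \<le> f (Suc i)"
    moreover have less: "f i < f (Suc i)" using f(1) by (simp add: strict_mono_less)
    ultimately have d: "nat (f (Suc i) - f i) \<in> {0..M-1}" by auto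
    have one: "a (- f k) = 1" for k using f(2) S[of "f k"] by auto
    \<comment> \<open>Signs reverse the order: this window starts at the later mode, and a gap below
      M would put the earlier one at a second offset in it.\<close>
    have "(\<Sum>k=0..M-1. a (- f (Suc i) + int k)) \<le> 1" using a unfolding Fib_inf_def by blast
    then have "0 = nat (f (Suc i) - f i)"
      unfolding sum_window_le_1_iff[of a, OF a01] using d one[of i] one[of "Suc i"] less by auto
    then show False using less by simp
  qed
qed

text \<open>The tail determines the charge, and the partition records how far each mode lies below
  that of the densest configuration of this charge.\<close>

lemma Fib_inf_eq_fib_conf:
  assumes M: "M > 0" and a: "a \<in> Fib_inf c (M - 1)"
  obtains n ls where "sorted_wrt (\<ge>) ls" "0 \<notin> set ls" "a = fib_conf M c n ls"
proof -
  define f where "f = increasing_enum {- j | j. a j = 1}"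
  note f = Fib_inf_enum[OF M a, folded f_def]
  obtain k q where kq: "\<And>r. r \<ge> 1 \<Longrightarrow> tau a (k + r) = - int c + (int (M - 1) + 1) * (q + int r)"
    using Fib_tau_tail[OF a] by blast
  have tail: "f (k + r) = - int c + int M * (q + int r + 1)" for r
    using kq[of "Suc r"] M by (simp add: tau_def f_def algebra_simps)
  \<comment> \<open>This charge makes the difference \<open>g\<close> vanish on the tail.\<close>
  define n where "n = int k - q"
  define g where "g i = (int i + 1 - n) * int M - int c - f i" for i
  have g_tail: "g (k + r) = 0" for r
    by (simp add: g_def tail n_def algebra_simps)
  \<comment> \<open>Gaps of at least M make \<open>g\<close> nonincreasing; being eventually zero,
    it is then nonnegative.\<close>
  have anti: "g j \<le> g i" if "i \<le> j" for i j
  proof (rule lift_Suc_antimono_le[OF _ that])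
    show "g (Suc i) \<le> g i" for i using f(2)[of i] by (simp add: g_def algebra_simps)
  qed
  have nonneg: "0 \<le> g i" for i
    using anti[of i "k + i"] g_tail[of i] by simp
  \<comment> \<open>Cutting at the first zero of \<open>g\<close> keeps exactly the positive
    parts.\<close>
  define m where "m = (LEAST i. g i = 0)"
  have gm: "g m = 0" unfolding m_def using g_tail[of 0] by (rule LeastI)
  have pos: "0 < g i" if "i < m" for i
    using nonneg[of i] not_less_Least[of i "\<lambda>i. g i = 0"] that unfolding m_def by force
  have zero: "g i = 0" if "m \<le> i" for i
    using anti[OF that] nonneg[of i] gm by simp
  define ls where "ls = map (\<lambda>i. nat (g i)) [0..<m]"
  have "sorted_wrt (\<ge>) ls"
    unfolding ls_def sorted_wrt_iff_nth_less using anti by (auto intro!: nat_mono)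
  moreover have "nat (g i) \<noteq> 0" if "i < m" for i using pos[OF that] by simp
  then have "0 \<notin> set ls" unfolding ls_def by fastforce
  moreover have "fib_pos M c n ls = f"
    using nonneg zero by (auto simp: fib_pos_def ls_def g_def fun_eq_iff not_less)
  then have "a j = fib_conf M c n ls j" for j
  proof -
    have "- j \<in> range f \<longleftrightarrow> a j = 1" unfolding f(1) by (auto intro: exI[of _ j])
    moreover have "a j \<in> {0, 1}" using a by (simp add: Fib_inf_def)
    ultimately show ?thesis using \<open>fib_pos M c n ls = f\<close> by (auto simp: fib_conf_def)
  qed
  ultimately show thesis by (intro that[of ls n]) auto
qed

section \<open>Semi-infinite monomials as monomials of partitions\<close>

lemma foldr_fib_pos_eq_part_vec:
  "foldr (\<lambda>i. vop_coeff M 1 (- fib_pos M c n ls i - int c)) [0..<length ls] (vac (n - int (length ls)))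
    = part_vec M n ls"
proof (induction ls arbitrary: n)
  case (Cons l ls)
  \<comment> \<open>Removing the first mode leaves the monomial of charge n - 1 and the remaining
    parts.\<close>
  have "fib_pos M c n (l # ls) (Suc i) = fib_pos M c (n - 1) ls i" for i
    by (simp add: fib_pos_def algebra_simps)
  then have "foldr (\<lambda>i. vop_coeff M 1 (- fib_pos M c n (l # ls) i - int c)) [0..<length (l # ls)]
        (vac (n - int (length (l # ls))))
      = vop_coeff M 1 (- fib_pos M c n (l # ls) 0 - int c)
        (foldr (\<lambda>i. vop_coeff M 1 (- fib_pos M c (n - 1) ls i - int c)) [0..<length ls]
          (vac (n - 1 - int (length ls))))"
    by (simp add: upt_conv_Cons map_Suc_upt[symmetric] foldr_map comp_def algebra_simps
        del: upt_Suc map_Suc_upt)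
  also have "\<dots> = part_vec M n (l # ls)"
    unfolding Cons.IH by (simp add: fib_pos_def algebra_simps)
  finally show ?case .
qed simp

text \<open>Common form of the two cases: M = 2N with c = N, and M = 2N + 1 with c = 0.\<close>

lemma is_basis_family_Fib_inf:
  assumes M: "M > 0"
    and g: "\<And>n ls. sorted_wrt (\<ge>) ls \<Longrightarrow> g (fib_conf M c n ls)
      = foldr (\<lambda>i. vop_coeff M 1 (- tau (fib_conf M c n ls) i - int c)) [1..<length ls + 1]
          (vac (n - int (length ls)))"
  shows "is_basis_family g (Fib_inf c (M - 1))"
proof (rule is_basis_family_reindex[OF is_basis_family_part_vec[OF M]])
  let ?p = "\<lambda>(n, A). fib_conf M c n (parts A)"
  have parts: "sorted_wrt (\<ge>) (parts A)" for A
    using parts_in_partitions[of A] by (simp add: partitions_def)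
  have g': "g (fib_conf M c n ls) = part_vec M n ls" if ls: "sorted_wrt (\<ge>) ls" for n ls
  proof -
    have "[1..<length ls + 1] = map Suc [0..<length ls]" by (simp add: map_Suc_upt)
    then show ?thesis
      by (simp only: g[OF ls] foldr_map comp_def tau_fib_conf[OF M ls] foldr_fib_pos_eq_part_vec)
  qed
  show "g (?p x) = (\<lambda>(n, A). part_vec M n (parts A)) x" for x
    by (cases x) (simp add: g' parts)
  show "range ?p = Fib_inf c (M - 1)"
  proof (intro equalityI subsetI)
    fix a assume "a \<in> Fib_inf c (M - 1)"
    then obtain n ls where ls: "sorted_wrt (\<ge>) ls" "0 \<notin> set ls" "a = fib_conf M c n ls"
      using Fib_inf_eq_fib_conf[OF M] by metis
    then have "ls \<in> partitions (sum_list ls)" by (simp add: partitions_def)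
    then obtain A where "ls = parts A" by (elim partitions_eq_parts)
    then show "a \<in> range ?p" using ls(3) by (intro image_eqI[of _ _ "(n, A)"]) auto
  qed (use fib_conf_in_Fib_inf[OF M parts] in auto)
qed

lemma is_basis_family_e_mono:
  assumes N: "1 \<le> N"
  shows "is_basis_family (e_mono N) (Fib_inf N (2 * N - 1))"
proof (rule is_basis_family_Fib_inf)
  show M: "2 * N > 0" using N by simp
  fix n ls assume ls: "sorted_wrt (\<ge>) (ls :: nat list)"
  \<comment> \<open>The monomial is cut after the last part: k is the length of \<open>ls\<close>
    and the vacuum has charge j = n - k. Since \<open>tau\<close> starts at 1 and
    \<open>fib_pos\<close> at 0, r is written as a successor.\<close>
  have "\<forall>r\<ge>1. tau (fib_conf (2 * N) N n ls) (length ls + r)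
      = (- 2 * (n - int (length ls)) + 2 * int r - 1) * int N"
  proof (intro allI impI)
    fix r :: nat assume "r \<ge> 1"
    then obtain s where "r = Suc s" by (cases r) auto
    then show "tau (fib_conf (2 * N) N n ls) (length ls + r)
        = (- 2 * (n - int (length ls)) + 2 * int r - 1) * int N"
      using tau_fib_conf[OF M ls, of N n "length ls + s"] by (simp add: fib_pos_tail algebra_simps)
  qed
  from e_mono_eq[OF N this]
  show "e_mono N (fib_conf (2 * N) N n ls)
      = foldr (\<lambda>i. vop_coeff (2 * N) 1 (- tau (fib_conf (2 * N) N n ls) i - int N))
          [1..<length ls + 1] (vac (n - int (length ls)))"
    by (simp only: e_mode_def)
qed

lemma is_basis_family_Theta_mono: "is_basis_family (Theta_mono N) (Fib_inf 0 (2 * N))"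
proof -
  have "is_basis_family (Theta_mono N) (Fib_inf 0 (2 * N + 1 - 1))"
  proof (rule is_basis_family_Fib_inf)
    show M: "2 * N + 1 > 0" by simp
    fix n ls assume ls: "sorted_wrt (\<ge>) (ls :: nat list)"
    have "\<forall>r\<ge>1. tau (fib_conf (2 * N + 1) 0 n ls) (length ls + r)
        = (int r - (n - int (length ls))) * (2 * int N + 1)"
    proof (intro allI impI)
      fix r :: nat assume "r \<ge> 1"
      then obtain s where "r = Suc s" by (cases r) auto
      then show "tau (fib_conf (2 * N + 1) 0 n ls) (length ls + r)
          = (int r - (n - int (length ls))) * (2 * int N + 1)"
        using tau_fib_conf[OF M ls, of 0 n "length ls + s"] by (simp add: fib_pos_tail algebra_simps)
    qed
    from Theta_mono_eq[OF this]
    show "Theta_mono N (fib_conf (2 * N + 1) 0 n ls)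
        = foldr (\<lambda>i. vop_coeff (2 * N + 1) 1 (- tau (fib_conf (2 * N + 1) 0 n ls) i - int 0))
            [1..<length ls + 1] (vac (n - int (length ls)))"
      by (simp only: theta_mode_def of_nat_0 diff_0_right)
  qed
  then show ?thesis by simp
qed

theorem theorem1p1:
  shows "(\<forall>N::nat. 1 \<le> N \<longrightarrow> is_basis_family (e_mono N) (Fib_inf N (2 * N - 1))) \<and>
         (\<forall>N::nat. 1 \<le> N \<longrightarrow> is_basis_family (Theta_mono N) (Fib_inf 0 (2 * N)))"
  using is_basis_family_e_mono is_basis_family_Theta_mono by blast

end
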